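(* There is a direct sum decomposition of categories $\mathcal{O}_\epsilon = \bigoplus_{\mu \in \mathfrak{h}^*} \mathcal{O}_\epsilon^\mu$.
   Context: Everything is over $\mathbb{C}$. $\mathfrak{g}$ is the Lie algebra of a connected reductive algebraic group; $\mathfrak{h}$ is a fixed maximal toral subalgebra, $\Phi^+$ a choice of positive roots, $\mathfrak n=\bigoplus_{\alpha\in\Phi^+}\mathfrak g_\alpha$ the sum of the positive root spaces. The Takiff algebra is $\mathfrak{g}_\epsilon=\mathfrak{g}\otimes\mathbb{C}[\epsilon]/(\epsilon^2)$; write $x=x\otimes 1$, $\overline{x}=x\otimes\epsilon$, and for a subspace $\mathfrak a\subseteq\mathfrak g$ write $\overline{\mathfrak a}=\mathfrak a\otimes\epsilon$, $\mathfrak a_\epsilon=\mathfrak a\oplus\overline{\mathfrak a}$. The category $\mathcal O_\epsilon$ is the full subcategory of $U(\mathfrak g_\epsilon)$-modules $M$ that are finitely generated, on which $\mathfrak h$ acts semisimply, and on which $\mathfrak n_\epsilon$ and $\overline{\mathfrak h}$ act locally finitely. For $M\in\mathcal O_\epsilon$ and $\mu\in\mathfrak h^*$, let $M^{(-,\mu)}$ be the set of $m\in M$ such that for every $h\in\mathfrak h$ there is $n\in\mathbb N$ with $(\overline h-\mu(h))^n\cdot m=0$. $\mathcal O_\epsilon^\mu$ is the full subcategory of $\mathcal O_\epsilon$ of modules $M$ with $M=M^{(-,\mu)}$. The direct sum decomposition means: every $M\in\mathcal O_\epsilon$ is the direct sum, as a $U(\mathfrak g_\epsilon)$-module, of submodules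 belonging to the $\mathcal O_\epsilon^\mu$ (finitely many of them nonzero), and there are no nonzero homomorphisms between objects of $\mathcal O_\epsilon^\mu$ and $\mathcal O_\epsilon^{\mu'}$ for $\mu\ne\mu'$. *)

theory Defs
  imports "HOL-Analysis.Analysis"
begin

section \<open>Linear algebraic groups over the complex numbers\<close>

inductive poly_fun :: "(complex^'n^'n \<Rightarrow> complex) \<Rightarrow> bool" where
  const: "poly_fun (\<lambda>g. c)"
| coord: "poly_fun (\<lambda>g. g $ i $ j)"
| add: "poly_fun p \<Longrightarrow> poly_fun q \<Longrightarrow> poly_fun (\<lambda>g. p g + q g)"
| mult: "poly_fun p \<Longrightarrow> poly_fun q \<Longrightarrow> poly_fun (\<lambda>g. p g * q g)"

text \<open>Zariski-closed subsets of the general linear group. Powers of the determinant can be cleared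
  from regular functions, so polynomials in the matrix entries suffice as equations.\<close>

definition zariski_closed_GL :: "(complex^'n^'n) set \<Rightarrow> bool" where
  "zariski_closed_GL Z \<longleftrightarrow>
     (\<exists>F. (\<forall>p\<in>F. poly_fun p) \<and> Z = {g. invertible g \<and> (\<forall>p\<in>F. p g = 0)})"

definition linear_algebraic_group :: "(complex^'n^'n) set \<Rightarrow> bool" where
  "linear_algebraic_group G \<longleftrightarrow>
     zariski_closed_GL G \<and> mat 1 \<in> G \<and>
     (\<forall>a\<in>G. \<forall>b\<in>G. a ** b \<in> G) \<and> (\<forall>a\<in>G. matrix_inv a \<in> G)"

definition zariski_connected :: "(complex^'n^'n) set \<Rightarrow> bool" where
  "zariski_connected G \<longleftrightarrow>
     \<not> (\<exists>A B. zariski_closed_GL A \<and> zariski_closed_GL B \<and> A \<union> B = G \<and> A \<inter> B = {} \<and>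
              A \<noteq> {} \<and> B \<noteq> {})"

text \<open>The power operation on the type of matrices is the componentwise one, so the
  powers of \<open>u - 1\<close> are written with iterated matrix multiplication.\<close>

definition unipotent :: "complex^'n^'n \<Rightarrow> bool" where
  "unipotent u \<longleftrightarrow> (\<exists>k. (((**) (u - mat 1)) ^^ k) (mat 1) = 0)"

definition semisimple_matrix :: "complex^'n^'n \<Rightarrow> bool" where
  "semisimple_matrix X \<longleftrightarrow>
     (\<exists>P :: complex^'n^'n. invertible P \<and> (\<forall>i j. i \<noteq> j \<longrightarrow> (matrix_inv P ** X ** P) $ i $ j = 0))"

text \<open>Reductive means that the unipotent radical, i.e. the largest closed connected normal
  unipotent subgroup, is trivial.\<close>

definition connected_reductive_group :: "(complex^'n^'n) set \<Rightarrow> bool" where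
  "connected_reductive_group G \<longleftrightarrow>
     linear_algebraic_group G \<and> zariski_connected G \<and>
     (\<forall>U. linear_algebraic_group U \<and> U \<subseteq> G \<and> (\<forall>g\<in>G. \<forall>u\<in>U. g ** u ** matrix_inv g \<in> U) \<and>
          zariski_connected U \<and> (\<forall>u\<in>U. unipotent u)
        \<longrightarrow> U = {mat 1})"

definition mat_scale :: "complex \<Rightarrow> complex^'n^'n \<Rightarrow> complex^'n^'n" where
  "mat_scale c X = (\<chi> i j. c * X $ i $ j)"

text \<open>The Zariski tangent space of the group at the identity.\<close>

definition lie_of :: "(complex^'n^'n) set \<Rightarrow> (complex^'n^'n) set" where
  "lie_of G = {X. \<forall>p. poly_fun p \<and> (\<forall>g\<in>G. p g = 0) \<longrightarrow>
      ((\<lambda>t. p (mat 1 + mat_scale t X)) has_field_derivative 0) (at 0)}"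


section \<open>Complex Lie algebras\<close>

locale lie_algebra = vector_space sc
  for sc :: "complex \<Rightarrow> 'g::ab_group_add \<Rightarrow> 'g" +
  fixes bracket :: "'g \<Rightarrow> 'g \<Rightarrow> 'g"
  assumes bracket_add_left: "bracket (x + y) z = bracket x z + bracket y z"
    and bracket_add_right: "bracket x (y + z) = bracket x y + bracket x z"
    and bracket_scale_left: "bracket (sc c x) y = sc c (bracket x y)"
    and bracket_scale_right: "bracket x (sc c y) = sc c (bracket x y)"
    and bracket_self: "bracket x x = 0"
    and jacobi: "bracket x (bracket y z) + bracket y (bracket z x) + bracket z (bracket x y) = 0"

text \<open>The Lie algebra on the type \<open>'g\<close> is identified with the Lie algebra of \<open>G\<close>
  by the isomorphism \<open>\<phi>\<close>.\<close>

definition lie_algebra_of_group ::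
  "(complex \<Rightarrow> 'g::ab_group_add \<Rightarrow> 'g) \<Rightarrow> ('g \<Rightarrow> 'g \<Rightarrow> 'g) \<Rightarrow> (complex^'n^'n) set \<Rightarrow> ('g \<Rightarrow> complex^'n^'n) \<Rightarrow> bool"
  where
  "lie_algebra_of_group sc bracket G \<phi> \<longleftrightarrow>
     lie_algebra sc bracket \<and>
     (\<forall>x y. \<phi> (x + y) = \<phi> x + \<phi> y) \<and> (\<forall>c x. \<phi> (sc c x) = mat_scale c (\<phi> x)) \<and>
     bij_betw \<phi> UNIV (lie_of G) \<and>
     (\<forall>x y. \<phi> (bracket x y) = \<phi> x ** \<phi> y - \<phi> y ** \<phi> x)"

definition toral_subalgebra ::
  "(complex \<Rightarrow> 'g::ab_group_add \<Rightarrow> 'g) \<Rightarrow> ('g \<Rightarrow> 'g \<Rightarrow> 'g) \<Rightarrow> ('g \<Rightarrow> complex^'n^'n) \<Rightarrow> 'g set \<Rightarrow> bool" where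
  "toral_subalgebra sc bracket \<phi> H \<longleftrightarrow>
     module.subspace sc H \<and> (\<forall>x\<in>H. \<forall>y\<in>H. bracket x y \<in> H) \<and>
     (\<forall>x\<in>H. semisimple_matrix (\<phi> x))"

definition maximal_toral_subalgebra ::
  "(complex \<Rightarrow> 'g::ab_group_add \<Rightarrow> 'g) \<Rightarrow> ('g \<Rightarrow> 'g \<Rightarrow> 'g) \<Rightarrow> ('g \<Rightarrow> complex^'n^'n) \<Rightarrow> 'g set \<Rightarrow> bool" where
  "maximal_toral_subalgebra sc bracket \<phi> H \<longleftrightarrow>
     toral_subalgebra sc bracket \<phi> H \<and>
     (\<forall>H'. toral_subalgebra sc bracket \<phi> H' \<and> H \<subseteq> H' \<longrightarrow> H' = H)"

text \<open>Functionals on the subspace \<open>H\<close> are represented by functions on the whole type that vanish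
  outside \<open>H\<close>; this makes the representation unique and compatible with \<open>0\<close>, \<open>+\<close> and \<open>-\<close>.\<close>

definition dual :: "(complex \<Rightarrow> 'g::ab_group_add \<Rightarrow> 'g) \<Rightarrow> 'g set \<Rightarrow> ('g \<Rightarrow> complex) set" where
  "dual sc H = {\<mu>. (\<forall>x\<in>H. \<forall>y\<in>H. \<mu> (x + y) = \<mu> x + \<mu> y) \<and>
                      (\<forall>c. \<forall>x\<in>H. \<mu> (sc c x) = c * \<mu> x) \<and> (\<forall>x. x \<notin> H \<longrightarrow> \<mu> x = 0)}"

definition root_space ::
  "(complex \<Rightarrow> 'g::ab_group_add \<Rightarrow> 'g) \<Rightarrow> ('g \<Rightarrow> 'g \<Rightarrow> 'g) \<Rightarrow> 'g set \<Rightarrow> ('g \<Rightarrow> complex) \<Rightarrow> 'g set" where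
  "root_space sc bracket H \<alpha> = {x. \<forall>h\<in>H. bracket h x = sc (\<alpha> h) x}"

definition roots ::
  "(complex \<Rightarrow> 'g::ab_group_add \<Rightarrow> 'g) \<Rightarrow> ('g \<Rightarrow> 'g \<Rightarrow> 'g) \<Rightarrow> 'g set \<Rightarrow> ('g \<Rightarrow> complex) set" where
  "roots sc bracket H =
     {\<alpha> \<in> dual sc H. \<alpha> \<noteq> (\<lambda>h. 0) \<and> root_space sc bracket H \<alpha> \<noteq> {0}}"

definition positive_system ::
  "(complex \<Rightarrow> 'g::ab_group_add \<Rightarrow> 'g) \<Rightarrow> ('g \<Rightarrow> 'g \<Rightarrow> 'g) \<Rightarrow> 'g set \<Rightarrow> ('g \<Rightarrow> complex) set \<Rightarrow> bool" where
  "positive_system sc bracket H P \<longleftrightarrow>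
     P \<subseteq> roots sc bracket H \<and>
     (\<forall>\<alpha>\<in>roots sc bracket H. (\<alpha> \<in> P) \<noteq> ((\<lambda>h. - \<alpha> h) \<in> P)) \<and>
     (\<forall>\<alpha>\<in>P. \<forall>\<beta>\<in>P. (\<lambda>h. \<alpha> h + \<beta> h) \<in> roots sc bracket H \<longrightarrow> (\<lambda>h. \<alpha> h + \<beta> h) \<in> P)"

definition positive_part ::
  "(complex \<Rightarrow> 'g::ab_group_add \<Rightarrow> 'g) \<Rightarrow> ('g \<Rightarrow> 'g \<Rightarrow> 'g) \<Rightarrow> 'g set \<Rightarrow> ('g \<Rightarrow> complex) set \<Rightarrow> 'g set" where
  "positive_part sc bracket H P = module.span sc (\<Union>\<alpha>\<in>P. root_space sc bracket H \<alpha>)"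


section \<open>Takiff algebras\<close>

text \<open>The pair \<open>(x, y)\<close> stands for \<open>x \<otimes> 1 + y \<otimes> \<epsilon>\<close> in \<open>\<gg> \<otimes> \<complex>[\<epsilon>]/(\<epsilon>\<^sup>2)\<close>.\<close>

definition takiff_scale :: "(complex \<Rightarrow> 'g \<Rightarrow> 'g) \<Rightarrow> complex \<Rightarrow> 'g \<times> 'g \<Rightarrow> 'g \<times> 'g" where
  "takiff_scale sc c u = (sc c (fst u), sc c (snd u))"

definition takiff_bracket :: "('g::ab_group_add \<Rightarrow> 'g \<Rightarrow> 'g) \<Rightarrow> 'g \<times> 'g \<Rightarrow> 'g \<times> 'g \<Rightarrow> 'g \<times> 'g" where
  "takiff_bracket bracket u v =
     (bracket (fst u) (fst v), bracket (fst u) (snd v) + bracket (snd u) (fst v))"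

lemma (in lie_algebra) lie_algebra_takiff:
  "lie_algebra (takiff_scale sc) (takiff_bracket bracket)"
proof
  fix x y z :: "'g \<times> 'g" and c d :: complex
  show "takiff_bracket bracket x x = 0"
  proof -
    have "bracket a b + bracket b a = 0" for a b
      using bracket_self[of "a + b"]
      by (simp add: bracket_self[of a] bracket_self[of b] bracket_add_left bracket_add_right add.commute)
    then show ?thesis by (simp add: takiff_bracket_def bracket_self zero_prod_def)
  qed
  show "takiff_bracket bracket x (takiff_bracket bracket y z) +
        takiff_bracket bracket y (takiff_bracket bracket z x) +
        takiff_bracket bracket z (takiff_bracket bracket x y) = 0"
  proof -
    have 1: "bracket (fst x) (bracket (fst y) (snd z)) + bracket (fst y) (bracket (snd z) (fst x)) +
       bracket (snd z) (bracket (fst x) (fst y)) = 0" by (rule jacobi)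
    have 2: "bracket (fst x) (bracket (snd y) (fst z)) + bracket (snd y) (bracket (fst z) (fst x)) +
       bracket (fst z) (bracket (fst x) (snd y)) = 0" by (rule jacobi)
    have 3: "bracket (snd x) (bracket (fst y) (fst z)) + bracket (fst y) (bracket (fst z) (snd x)) +
       bracket (fst z) (bracket (snd x) (fst y)) = 0" by (rule jacobi)
    have "(bracket (fst x) (bracket (fst y) (snd z)) + bracket (fst x) (bracket (snd y) (fst z))
        + bracket (snd x) (bracket (fst y) (fst z)))
      + (bracket (fst y) (bracket (fst z) (snd x)) + bracket (fst y) (bracket (snd z) (fst x))
        + bracket (snd y) (bracket (fst z) (fst x)))
      + (bracket (fst z) (bracket (fst x) (snd y)) + bracket (fst z) (bracket (snd x) (fst y))
        + bracket (snd z) (bracket (fst x) (fst y))) = 0 + 0 + 0"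
      using arg_cong2[OF arg_cong2[OF 1 2, of "(+)"] 3, of "(+)"] by (simp add: ac_simps)
    then show ?thesis
      by (simp add: takiff_bracket_def jacobi bracket_add_right zero_prod_def)
  qed
qed (simp_all add: takiff_scale_def takiff_bracket_def scale_right_distrib scale_left_distrib
      bracket_add_left bracket_add_right bracket_scale_left bracket_scale_right prod_eq_iff)


section \<open>Modules over Lie algebras\<close>

text \<open>A \<open>U(L)\<close>-module is given as a representation of \<open>L\<close>. Its underlying space is a subspace
  \<open>M\<close> of the type \<open>'m\<close>, so that submodules are modules on smaller carriers; the action
  is only relevant on \<open>M\<close>.\<close>

locale lie_module = lie_algebra sc bracket + V: vector_space sm
  for sc :: "complex \<Rightarrow> 'l::ab_group_add \<Rightarrow> 'l"
    and bracket :: "'l \<Rightarrow> 'l \<Rightarrow> 'l"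
    and sm :: "complex \<Rightarrow> 'm::ab_group_add \<Rightarrow> 'm" +
  fixes act :: "'l \<Rightarrow> 'm \<Rightarrow> 'm"
    and M :: "'m set"
  assumes carrier_subspace: "V.subspace M"
    and act_closed: "m \<in> M \<Longrightarrow> act x m \<in> M"
    and act_add: "m \<in> M \<Longrightarrow> m' \<in> M \<Longrightarrow> act x (m + m') = act x m + act x m'"
    and act_scale: "m \<in> M \<Longrightarrow> act x (sm c m) = sm c (act x m)"
    and add_act: "m \<in> M \<Longrightarrow> act (x + y) m = act x m + act y m"
    and scale_act: "m \<in> M \<Longrightarrow> act (sc c x) m = sm c (act x m)"
    and bracket_act: "m \<in> M \<Longrightarrow> act (bracket x y) m = act x (act y m) - act y (act x m)"

text \<open>For a subalgebra \<open>A\<close>, \<open>env_span sm act A S\<close> is \<open>U(A) \<cdot> S\<close>, the span of all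
  \<open>x\<^sub>1 \<cdots> x\<^sub>k \<cdot> s\<close> with \<open>x\<^sub>i \<in> A\<close> and \<open>s \<in> S\<close>.\<close>

inductive_set monomials :: "('l \<Rightarrow> 'm \<Rightarrow> 'm) \<Rightarrow> 'l set \<Rightarrow> 'm set \<Rightarrow> 'm set"
  for act :: "'l \<Rightarrow> 'm \<Rightarrow> 'm" and A :: "'l set" and S :: "'m set" where
  gen: "s \<in> S \<Longrightarrow> s \<in> monomials act A S"
| step: "x \<in> A \<Longrightarrow> v \<in> monomials act A S \<Longrightarrow> act x v \<in> monomials act A S"

definition env_span ::
  "(complex \<Rightarrow> 'm::ab_group_add \<Rightarrow> 'm) \<Rightarrow> ('l \<Rightarrow> 'm \<Rightarrow> 'm) \<Rightarrow> 'l set \<Rightarrow> 'm set \<Rightarrow> 'm set" where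
  "env_span sm act A S = module.span sm (monomials act A S)"

definition finitely_generated ::
  "(complex \<Rightarrow> 'm::ab_group_add \<Rightarrow> 'm) \<Rightarrow> ('l \<Rightarrow> 'm \<Rightarrow> 'm) \<Rightarrow> 'm set \<Rightarrow> bool" where
  "finitely_generated sm act M \<longleftrightarrow> (\<exists>S. finite S \<and> S \<subseteq> M \<and> env_span sm act UNIV S = M)"

definition acts_locally_finitely ::
  "(complex \<Rightarrow> 'm::ab_group_add \<Rightarrow> 'm) \<Rightarrow> ('l \<Rightarrow> 'm \<Rightarrow> 'm) \<Rightarrow> 'l set \<Rightarrow> 'm set \<Rightarrow> bool" where
  "acts_locally_finitely sm act A M \<longleftrightarrow>
     (\<forall>m\<in>M. \<exists>B. finite B \<and> env_span sm act A {m} \<subseteq> module.span sm B)"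

definition module_hom_on ::
  "(complex \<Rightarrow> 'm::ab_group_add \<Rightarrow> 'm) \<Rightarrow> ('l \<Rightarrow> 'm \<Rightarrow> 'm) \<Rightarrow> 'm set \<Rightarrow>
   (complex \<Rightarrow> 'k::ab_group_add \<Rightarrow> 'k) \<Rightarrow> ('l \<Rightarrow> 'k \<Rightarrow> 'k) \<Rightarrow> 'k set \<Rightarrow> ('m \<Rightarrow> 'k) \<Rightarrow> bool" where
  "module_hom_on sm act M sn act' N f \<longleftrightarrow>
     (\<forall>m\<in>M. f m \<in> N) \<and> (\<forall>m\<in>M. \<forall>m'\<in>M. f (m + m') = f m + f m') \<and>
     (\<forall>c. \<forall>m\<in>M. f (sm c m) = sn c (f m)) \<and> (\<forall>x. \<forall>m\<in>M. f (act x m) = act' x (f m))"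

definition internal_direct_sum :: "'i set \<Rightarrow> ('i \<Rightarrow> 'm::ab_group_add set) \<Rightarrow> 'm set \<Rightarrow> bool" where
  "internal_direct_sum I D M \<longleftrightarrow>
     (\<forall>i\<in>I. D i \<subseteq> M) \<and>
     (\<forall>m\<in>M. \<exists>!c. (\<forall>i\<in>I. c i \<in> D i) \<and> (\<forall>i. i \<notin> I \<longrightarrow> c i = 0) \<and> finite {i. c i \<noteq> 0} \<and>
                 m = (\<Sum>i | c i \<noteq> 0. c i))"


section \<open>Category O for Takiff algebras\<close>

text \<open>The semisimple action of \<open>H\<close> is expressed by \<open>M\<close> being spanned by weight vectors.\<close>

definition category_O ::
  "(complex \<Rightarrow> 'g::ab_group_add \<Rightarrow> 'g) \<Rightarrow> ('g \<Rightarrow> 'g \<Rightarrow> 'g) \<Rightarrow> 'g set \<Rightarrow> ('g \<Rightarrow> complex) set \<Rightarrow>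
   (complex \<Rightarrow> 'm::ab_group_add \<Rightarrow> 'm) \<Rightarrow> ('g \<times> 'g \<Rightarrow> 'm \<Rightarrow> 'm) \<Rightarrow> 'm set \<Rightarrow> bool" where
  "category_O sc bracket H P sm act M \<longleftrightarrow>
     lie_module (takiff_scale sc) (takiff_bracket bracket) sm act M \<and>
     finitely_generated sm act M \<and>
     M = module.span sm {m \<in> M. \<exists>\<nu>\<in>dual sc H. \<forall>h\<in>H. act (h, 0) m = sm (\<nu> h) m} \<and>
     acts_locally_finitely sm act (positive_part sc bracket H P \<times> positive_part sc bracket H P) M \<and>
     acts_locally_finitely sm act ({0} \<times> H) M"

definition gen_weight_space ::
  "'g::ab_group_add set \<Rightarrow> (complex \<Rightarrow> 'm::ab_group_add \<Rightarrow> 'm) \<Rightarrow> ('g \<times> 'g \<Rightarrow> 'm \<Rightarrow> 'm) \<Rightarrow> 'm set \<Rightarrow>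
   ('g \<Rightarrow> complex) \<Rightarrow> 'm set" where
  "gen_weight_space H sm act M \<mu> =
     {m \<in> M. \<forall>h\<in>H. \<exists>n. ((\<lambda>v. act (0, h) v - sm (\<mu> h) v) ^^ n) m = 0}"

definition category_O_mu ::
  "(complex \<Rightarrow> 'g::ab_group_add \<Rightarrow> 'g) \<Rightarrow> ('g \<Rightarrow> 'g \<Rightarrow> 'g) \<Rightarrow> 'g set \<Rightarrow> ('g \<Rightarrow> complex) set \<Rightarrow>
   ('g \<Rightarrow> complex) \<Rightarrow>
   (complex \<Rightarrow> 'm::ab_group_add \<Rightarrow> 'm) \<Rightarrow> ('g \<times> 'g \<Rightarrow> 'm \<Rightarrow> 'm) \<Rightarrow> 'm set \<Rightarrow> bool" where
  "category_O_mu sc bracket H P \<mu> sm act M \<longleftrightarrow>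
     category_O sc bracket H P sm act M \<and> M = gen_weight_space H sm act M \<mu>"

end

(*
  The operators of the elements (0, h) commute and act locally finitely, so every vector lies in a
  finite-dimensional subspace stable under all of them, and Fitting's lemma splits that subspace into
  simultaneous generalized eigenspaces. Because epsilon^2 = 0, ad (0, h) squares to zero on the Takiff
  algebra; hence generalized eigenspaces are stable under the whole algebra and no linkage through
  roots can occur. The projections onto the summands are module homomorphisms, so finite generation
  and weight vectors descend to the summands, and only finitely many summands are nonzero.
*)
theory Submission
  imports Defs "HOL-Computational_Algebra.Fundamental_Theorem_Algebra"
begin

section \<open>Operators on subspaces\<close>

text \<open>The obstacle is that the operators form a family indexed by all of \<open>H\<close> and
  that a weight must be a linear functional on \<open>H\<close>, whereas spectral analysis gives one
  number for each operator separately. Hence the splitting is an induction on dimension: a stable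
  subspace is cut as soon as one operator has no single eigenvalue on it, and on a subspace that
  cannot be cut any more every operator has exactly one eigenvalue. Linearity of these numbers in
  \<open>h\<close> is then read off from common eigenvectors. A cut is always proper: over an
  algebraically closed field the chosen operator has an eigenvalue c, so subtracting c leaves a map
  that is not surjective, and it is not nilpotent by the choice of the operator. An action is
  meaningful only on its carrier, inside an ambient space of arbitrary dimension, so all linear
  algebra is relative to a subspace contained in a finite span.\<close>

definition operator_on ::
  "('a::field \<Rightarrow> 'b::ab_group_add \<Rightarrow> 'b) \<Rightarrow> 'b set \<Rightarrow> ('b \<Rightarrow> 'b) \<Rightarrow> bool" where
  "operator_on s W A \<longleftrightarrow> module.subspace s W \<and> (\<forall>v\<in>W. A v \<in> W) \<and>
     (\<forall>u\<in>W. \<forall>v\<in>W. A (u + v) = A u + A v) \<and> (\<forall>c. \<forall>v\<in>W. A (s c v) = s c (A v))"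

context vector_space
begin

lemma operator_onD:
  assumes "operator_on scale W A"
  shows operator_on_subspace: "subspace W"
    and operator_on_closed: "v \<in> W \<Longrightarrow> A v \<in> W"
    and operator_on_add: "u \<in> W \<Longrightarrow> v \<in> W \<Longrightarrow> A (u + v) = A u + A v"
    and operator_on_scale: "v \<in> W \<Longrightarrow> A (scale c v) = scale c (A v)"
  using assms by (auto simp: operator_on_def)

lemma operator_on_0: "operator_on scale W A \<Longrightarrow> A 0 = 0"
  using operator_on_scale[of W A 0 0] operator_on_subspace subspace_0 by fastforce

lemma operator_on_diff:
  assumes "operator_on scale W A" "u \<in> W" "v \<in> W"
  shows "A (u - v) = A u - A v"
  using operator_on_add[OF assms(1), of "u - v" v] assms operator_on_subspace subspace_diff
  by fastforce

lemma operator_on_sum: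
  assumes "operator_on scale W A" "\<And>i. i \<in> I \<Longrightarrow> f i \<in> W"
  shows "A (sum f I) = (\<Sum>i\<in>I. A (f i))"
  using assms(2)
proof (induction I rule: infinite_finite_induct)
  case (insert i I)
  then have "sum f I \<in> W"
    using subspace_sum[OF operator_on_subspace[OF assms(1)], of I f] by blast
  with insert operator_on_add[OF assms(1)] show ?case by auto
qed (simp_all add: operator_on_0[OF assms(1)])

lemma operator_on_funpow:
  assumes "operator_on scale W A"
  shows "operator_on scale W (A ^^ n)"
proof (induction n)
  case 0
  show ?case using operator_on_subspace[OF assms] by (simp add: operator_on_def)
next
  case (Suc n)
  with assms show ?case by (auto simp: operator_on_def)
qed

lemma operator_on_subset:
  "operator_on scale W A \<Longrightarrow> subspace U \<Longrightarrow> U \<subseteq> W \<Longrightarrow> (\<And>v. v \<in> U \<Longrightarrow> A v \<in> U) \<Longrightarrow> operator_on scale U A"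
  by (auto simp: operator_on_def subset_eq)

lemma operator_on_shift:
  assumes "operator_on scale W A"
  shows "operator_on scale W (\<lambda>v. A v - scale c v)"
  unfolding operator_on_def
  using operator_onD[OF assms]
  by (auto simp: subspace_diff subspace_scale scale_right_distrib scale_right_diff_distrib mult.commute)

lemma subspace_kernel_on:
  assumes "operator_on scale W A"
  shows "subspace {v \<in> W. A v = 0}"
  using operator_onD[OF assms] operator_on_0[OF assms]
  by (auto simp: subspace_def)

lemma subspace_image_on:
  assumes "operator_on scale W A"
  shows "subspace (A ` W)"
proof (rule subspaceI)
  note W = operator_on_subspace[OF assms]
  show "0 \<in> A ` W" using operator_on_0[OF assms] subspace_0[OF W] by force
  show "x + y \<in> A ` W" if "x \<in> A ` W" "y \<in> A ` W" for x y
    using that operator_on_add[OF assms, symmetric] subspace_add[OF W] by (auto simp del: add_left_imp_eq)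
  show "scale c x \<in> A ` W" if "x \<in> A ` W" for c x
    using that operator_on_scale[OF assms, symmetric] subspace_scale[OF W] by auto
qed

section \<open>Fitting's lemma, and injectivity from surjectivity, inside a finite span\<close>

lemma dim_psubset_subspace:
  assumes "subspace U" "U \<subset> W" "W \<subseteq> span B" "finite B"
  shows "dim U < dim W"
proof -
  obtain C where C: "C \<subseteq> U" "independent C" "U \<subseteq> span C" "card C = dim U"
    using basis_exists .
  obtain w where w: "w \<in> W" "w \<notin> U" using assms(2) by blast
  have "span C = U" using C assms(1) span_minimal by blast
  then have "independent (insert w C)" using w C independent_insertI by blast
  moreover have "insert w C \<subseteq> W" using w C assms(2) by blast
  ultimately obtain D where D: "insert w C \<subseteq> D" "D \<subseteq> W" "independent D" "W \<subseteq> span D"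
    using maximal_independent_subset_extend by blast
  have fin: "finite D"
    using independent_span_bound[OF assms(4) D(3)] D(2) assms(3) by blast
  have "dim U < card (insert w C)"
    using C w fin D(1) finite_subset by (subst card_insert_disjoint) (auto intro: finite_subset)
  also have "\<dots> \<le> card D" using D(1) fin by (rule card_mono[rotated])
  also have "\<dots> = dim W" using D basis_card_eq_dim by blast
  finally show ?thesis .
qed

text \<open>The images of the powers decrease, so a power whose image has least dimension is already
  stable. The bound \<open>n > 0\<close> puts the stable image inside the image of \<open>A\<close>,
  so that a non-surjective \<open>A\<close> yields a proper piece.\<close>

lemma funpow_image_stabilizes:
  assumes "operator_on scale W A" "W \<subseteq> span B" "finite B"
  shows "\<exists>n>0. \<forall>k. (A ^^ (n + k)) ` W = (A ^^ n) ` W"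
proof -
  obtain n :: nat where n: "n > 0" and least: "\<And>k. k > 0 \<Longrightarrow> dim ((A ^^ n) ` W) \<le> dim ((A ^^ k) ` W)"
    using ex_has_least_nat[of "\<lambda>n. n > 0" 1 "\<lambda>n. dim ((A ^^ n) ` W)"] by auto
  have "(A ^^ (n + k)) ` W = (A ^^ n) ` W" for k
  proof (rule ccontr)
    assume ne: "(A ^^ (n + k)) ` W \<noteq> (A ^^ n) ` W"
    have "(A ^^ (n + k)) ` W \<subseteq> (A ^^ n) ` W"
      using operator_on_closed[OF operator_on_funpow[OF assms(1)]]
      by (auto simp: funpow_add)
    moreover have "(A ^^ n) ` W \<subseteq> span B"
      using operator_on_closed[OF operator_on_funpow[OF assms(1)]] assms(2) by blast
    ultimately have "dim ((A ^^ (n + k)) ` W) < dim ((A ^^ n) ` W)"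
      using ne subspace_image_on[OF operator_on_funpow[OF assms(1)]] assms(3)
      by (intro dim_psubset_subspace) auto
    then show False using least[of "n + k"] n by simp
  qed
  with n show ?thesis by blast
qed

text \<open>Stability of the image gives \<open>A^n v = A^(2n) u\<close> for some \<open>u\<close>,
  so \<open>v - A^n u\<close> lies in the kernel. This is W = ker A^n + im A^n, vector by
  vector.\<close>

lemma fitting_decomposition:
  assumes "operator_on scale W A" "W \<subseteq> span B" "finite B"
  shows "\<exists>n>0. \<forall>v\<in>W. \<exists>u\<in>W. (A ^^ n) (v - (A ^^ n) u) = 0"
proof -
  obtain n where n: "n > 0" "\<And>k. (A ^^ (n + k)) ` W = (A ^^ n) ` W"
    using funpow_image_stabilizes[OF assms] by blast
  note An = operator_on_funpow[OF assms(1), of n]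
  have "\<exists>u\<in>W. (A ^^ n) (v - (A ^^ n) u) = 0" if "v \<in> W" for v
  proof -
    have "(A ^^ n) v \<in> (A ^^ (n + n)) ` W" using that n(2) by blast
    then obtain u where "u \<in> W" "(A ^^ n) v = (A ^^ n) ((A ^^ n) u)"
      by (auto simp: funpow_add)
    then show ?thesis
      using operator_on_diff[OF An that operator_on_closed[OF An]] by auto
  qed
  with n(1) show ?thesis by blast
qed

text \<open>The kernels of the powers grow inside a finite span, so some kernel equals the next one.
  Writing \<open>v = A^n u\<close> by surjectivity puts \<open>u\<close> into the next kernel, hence
  into the kernel of \<open>A^n\<close>.\<close>

lemma injective_if_surjective_on:
  assumes "operator_on scale W A" "W \<subseteq> span B" "finite B" and surj: "A ` W = W" and v: "v \<in> W" "A v = 0"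
  shows "v = 0"
proof -
  let ?K = "\<lambda>n. {v \<in> W. (A ^^ n) v = 0}"
  have "dim (?K n) < Suc (card B)" for n
    using dim_le_card[of "?K n" B] assms(2,3) by (simp add: subset_eq less_Suc_eq_le)
  then obtain n where n: "\<And>k. dim (?K k) \<le> dim (?K n)"
    using ex_has_greatest_nat[of "\<lambda>_. True" 0 "\<lambda>n. dim (?K n)" "Suc (card B)"] by auto
  have sub: "?K n \<subseteq> ?K (Suc n)" using operator_on_0[OF assms(1)] by auto
  have "?K (Suc n) \<subseteq> span B" using assms(2) by blast
  then have eq: "?K n = ?K (Suc n)"
    using dim_psubset_subspace[OF subspace_kernel_on[OF operator_on_funpow[OF assms(1)]], of n "?K (Suc n)" B]
      assms(3) n[of "Suc n"] sub by (metis (no_types, lifting) leD psubsetI)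
  have "(A ^^ n) ` W = W" by (induction n) (simp, simp only: funpow.simps image_comp[symmetric] surj)
  then obtain u where u: "u \<in> W" "v = (A ^^ n) u" using v by blast
  then have "u \<in> ?K (Suc n)" using v by simp
  then show ?thesis using eq u by blast
qed

text \<open>The sums are values p(A) w of polynomials in the operator, and the identity is ((X - a)
  q)(A) = (A - a) q(A). The summation bound is a degree, which forces the separate case
  \<open>q = 0\<close>.\<close>

lemma sum_funpow_factor:
  assumes "operator_on scale W A" "w \<in> W"
  shows "(\<Sum>i\<le>degree ([:- a, 1:] * q). scale (coeff ([:- a, 1:] * q) i) ((A ^^ i) w)) =
     A (\<Sum>i\<le>degree q. scale (coeff q i) ((A ^^ i) w)) - scale a (\<Sum>i\<le>degree q. scale (coeff q i) ((A ^^ i) w))"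
proof (cases "q = 0")
  case True
  then show ?thesis using operator_on_0[OF assms(1)] by simp
next
  case False
  let ?q = "\<lambda>i. scale (coeff q i) ((A ^^ i) w)"
  note W = operator_on_subspace[OF assms(1)]
  have in_W: "(A ^^ i) w \<in> W" for i
    using operator_on_closed[OF operator_on_funpow[OF assms(1)] assms(2)] .
  have deg: "degree ([:- a, 1:] * q) = Suc (degree q)"
    using False by (subst degree_mult_eq) auto
  have "coeff ([:- a, 1:] * q) i = (case i of 0 \<Rightarrow> 0 | Suc j \<Rightarrow> coeff q j) - a * coeff q i" for i
    by (simp add: coeff_pCons split: nat.split)
  then have "(\<Sum>i\<le>degree ([:- a, 1:] * q). scale (coeff ([:- a, 1:] * q) i) ((A ^^ i) w)) =
      (\<Sum>i\<le>Suc (degree q). scale (case i of 0 \<Rightarrow> 0 | Suc j \<Rightarrow> coeff q j) ((A ^^ i) w)) -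
      (\<Sum>i\<le>Suc (degree q). scale a (?q i))"
    unfolding deg by (simp only: scale_left_diff_distrib sum_subtractf scale_scale)
  also have "(\<Sum>i\<le>Suc (degree q). scale (case i of 0 \<Rightarrow> 0 | Suc j \<Rightarrow> coeff q j) ((A ^^ i) w)) =
      (\<Sum>i\<le>degree q. scale (coeff q i) (A ((A ^^ i) w)))"
    by (subst sum.atMost_Suc_shift) simp
  also have "\<dots> = A (\<Sum>i\<le>degree q. ?q i)"
    using in_W W by (subst operator_on_sum[OF assms(1)])
      (auto simp: operator_on_scale[OF assms(1)] subspace_scale)
  also have "(\<Sum>i\<le>Suc (degree q). scale a (?q i)) = scale a (\<Sum>i\<le>degree q. ?q i)"
    by (simp add: scale_sum_right coeff_eq_0)
  finally show ?thesis .
qed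

text \<open>The N + 1 vectors w, A w, ..., A^N w lie in the span of N = \<open>card B\<close>
  vectors; a nontrivial relation among them is the coefficient list of \<open>p\<close>.\<close>

lemma annihilating_polynomial:
  assumes "operator_on scale W A" "W \<subseteq> span B" "finite B" "w \<in> W"
  shows "\<exists>p. p \<noteq> 0 \<and> (\<Sum>i\<le>degree p. scale (coeff p i) ((A ^^ i) w)) = 0"
proof -
  define N where "N = card B"
  have in_W: "(A ^^ i) w \<in> W" for i
    using operator_on_closed[OF operator_on_funpow[OF assms(1)] assms(4)] .
  \<comment> \<open>\<open>dependent\<close> speaks of sets, so a repetition among the iterates
    would be lost in the image. In that case the relation is the difference of two equal iterates,
    with coefficients 1 and -1.\<close>
  obtain a j where a: "j \<le> N" "a j \<noteq> 0" "(\<Sum>i\<le>N. scale (a i) ((A ^^ i) w)) = 0"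
  proof (cases "inj_on (\<lambda>i. (A ^^ i) w) {..N}")
    case True
    let ?S = "(\<lambda>i. (A ^^ i) w) ` {..N}"
    have "dependent ?S"
    proof (rule ccontr)
      assume "\<not> dependent ?S"
      then have "card ?S \<le> N"
        using independent_span_bound[OF assms(3)] in_W assms(2) unfolding N_def by blast
      then show False using card_image[OF True] by simp
    qed
    then obtain u where u: "\<exists>v\<in>?S. u v \<noteq> 0" "(\<Sum>v\<in>?S. scale (u v) v) = 0"
      using dependent_finite[of ?S] by auto
    then obtain j where "j \<le> N" "u ((A ^^ j) w) \<noteq> 0" by auto
    then show ?thesis
      using that[of j "\<lambda>i. u ((A ^^ i) w)"] u(2) by (simp add: sum.reindex[OF True])
  next
    case False
    then obtain i j where ij: "i \<le> N" "j \<le> N" "i \<noteq> j" "(A ^^ i) w = (A ^^ j) w"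
      by (auto simp: inj_on_def)
    show ?thesis
    proof (rule that[of j "\<lambda>k. if k = j then 1 else if k = i then - 1 else 0"])
      have "(\<Sum>k\<le>N. scale (if k = j then 1 else if k = i then - 1 else 0) ((A ^^ k) w)) =
          (\<Sum>k\<in>{i, j}. scale (if k = j then 1 else if k = i then - 1 else 0) ((A ^^ k) w))"
        using ij by (intro sum.mono_neutral_right) auto
      then show "(\<Sum>k\<le>N. scale (if k = j then 1 else if k = i then - 1 else 0) ((A ^^ k) w)) = 0"
        using ij by simp
    qed (use ij in auto)
  qed
  define p where "p = Poly (map a [0..<Suc N])"
  have coeff_p: "coeff p i = (if i \<le> N then a i else 0)" for i
    by (simp add: p_def nth_default_def nth_append less_Suc_eq_le del: upt_Suc)
  have "p \<noteq> 0" using a(1,2) coeff_p[of j] by auto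
  moreover have "degree p \<le> N" by (rule degree_le) (simp add: coeff_p)
  then have "(\<Sum>i\<le>degree p. scale (coeff p i) ((A ^^ i) w)) = (\<Sum>i\<le>N. scale (coeff p i) ((A ^^ i) w))"
    by (intro sum.mono_neutral_left) (auto simp: coeff_eq_0)
  then have "(\<Sum>i\<le>degree p. scale (coeff p i) ((A ^^ i) w)) = 0" using a(3) by (simp add: coeff_p)
  ultimately show ?thesis by blast
qed

end

text \<open>Linear factors X - a are stripped off an annihilating polynomial until q(A) w is nonzero
  while (A - a) q(A) w = 0. This must happen, since a nonzero constant does not annihilate
  \<open>w\<close>. The lemma stands outside the locale because its scalars must be algebraically
  closed.\<close>

lemma ex_eigenvector:
  fixes s :: "'a::alg_closed_field \<Rightarrow> 'b::ab_group_add \<Rightarrow> 'b"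
  assumes "vector_space s"
  assumes A: "operator_on s W A" and B: "W \<subseteq> module.span s B" "finite B"
    and w: "w \<in> W" "w \<noteq> 0"
  shows "\<exists>c v. v \<in> W \<and> v \<noteq> 0 \<and> A v = s c v"
proof -
  interpret vector_space s by fact
  obtain p where p: "p \<noteq> 0" "(\<Sum>i\<le>degree p. s (coeff p i) ((A ^^ i) w)) = 0"
    using annihilating_polynomial[OF A B w(1)] by blast
  then show ?thesis
  proof (induction "degree p" arbitrary: p)
    case 0
    then obtain c where "p = [:c:]" by (metis degree_eq_zeroE)
    with 0 w(2) show ?case by simp
  next
    case (Suc d)
    then obtain a where "poly p a = 0" using alg_closed_imp_poly_has_root[of p] by auto
    then obtain q where q: "p = [:- a, 1:] * q" by (auto simp: poly_eq_0_iff_dvd)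
    let ?v = "\<Sum>i\<le>degree q. s (coeff q i) ((A ^^ i) w)"
    have "q \<noteq> 0" using q Suc.prems(1) by auto
    then have "degree p = Suc (degree q)" unfolding q by (subst degree_mult_eq) auto
    show ?case
    proof (cases "?v = 0")
      case True
      then show ?thesis using Suc.hyps(1)[of q] Suc.hyps(2) \<open>q \<noteq> 0\<close> \<open>degree p = _\<close> by simp
    next
      case False
      have "A ?v - s a ?v = 0"
        using Suc.prems(2) unfolding q sum_funpow_factor[OF A w(1)] .
      moreover have "?v \<in> W"
        using operator_on_subspace[OF A] operator_on_closed[OF operator_on_funpow[OF A] w(1)]
        by (intro subspace_sum subspace_scale)
      ultimately show ?thesis using False by auto
    qed
  qed
qed

section \<open>Iterates of a map, and functionals that differ\<close>

lemma funpow_commute_on: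
  assumes "\<And>v. v \<in> M \<Longrightarrow> A v \<in> M" "\<And>v. v \<in> M \<Longrightarrow> A (B v) = B (A v)" "v \<in> M"
  shows "(A ^^ n) v \<in> M \<and> (A ^^ n) (B v) = B ((A ^^ n) v)"
  using assms by (induction n) auto

lemma funpow_eq_0_mono:
  fixes A :: "'a::zero \<Rightarrow> 'a"
  assumes "(A ^^ n) v = 0" "n \<le> k" "A 0 = 0"
  shows "(A ^^ k) v = 0"
  using assms(2)
proof (induction k rule: dec_induct)
  case (step k)
  then show ?case using assms(3) by simp
qed (fact assms(1))

text \<open>This is the last nonzero iterate. For a shifted operator it is a genuine eigenvector,
  which reduces comparisons of generalized eigenvalues to eigenvectors.\<close>

lemma funpow_kernel_nonzero:
  assumes "(A ^^ n) v = 0" "v \<noteq> 0"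
  shows "\<exists>k. (A ^^ k) v \<noteq> 0 \<and> A ((A ^^ k) v) = 0"
  using assms(1)
proof (induction n)
  case (Suc n)
  then show ?case by (cases "(A ^^ n) v = 0") auto
qed (use assms(2) in simp)

text \<open>Elements of \<open>dual\<close> vanish off \<open>H\<close>, so a disagreement must
  occur on \<open>H\<close>.\<close>

lemma dual_neq_obtains:
  assumes "\<mu> \<in> dual sc H" "\<nu> \<in> dual sc H" "\<mu> \<noteq> \<nu>"
  obtains h where "h \<in> H" "\<mu> h \<noteq> \<nu> h"
proof -
  obtain h where h: "\<mu> h \<noteq> \<nu> h" using assms(3) by auto
  then have "h \<in> H" using assms(1,2) by (cases "h \<in> H") (auto simp: dual_def)
  with h that show thesis by blast
qed

section \<open>Generalized weight spaces of commuting operators\<close>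

text \<open>Abstracts the action of the elements \<open>(0, h)\<close>. Finiteness is not part of
  the locale but is supplied by the stable subspaces to which it is applied.\<close>

locale commuting_operators = L: vector_space sc + V: vector_space sm
  for sc :: "complex \<Rightarrow> 'h::ab_group_add \<Rightarrow> 'h" and sm :: "complex \<Rightarrow> 'm::ab_group_add \<Rightarrow> 'm" +
  fixes H :: "'h set" and M :: "'m set" and T :: "'h \<Rightarrow> 'm \<Rightarrow> 'm"
  assumes H_subspace: "L.subspace H"
    and operator: "h \<in> H \<Longrightarrow> operator_on sm M (T h)"
    and add_T: "h \<in> H \<Longrightarrow> h' \<in> H \<Longrightarrow> m \<in> M \<Longrightarrow> T (h + h') m = T h m + T h' m"
    and scale_T: "h \<in> H \<Longrightarrow> m \<in> M \<Longrightarrow> T (sc c h) m = sm c (T h m)"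
    and commute: "h \<in> H \<Longrightarrow> h' \<in> H \<Longrightarrow> m \<in> M \<Longrightarrow> T h (T h' m) = T h' (T h m)"
begin

definition shift :: "'h \<Rightarrow> complex \<Rightarrow> 'm \<Rightarrow> 'm" where
  "shift h c v = T h v - sm c v"

definition weight_part :: "('h \<Rightarrow> complex) \<Rightarrow> 'm set" where
  "weight_part \<mu> = {m \<in> M. \<forall>h\<in>H. \<exists>n. (shift h (\<mu> h) ^^ n) m = 0}"

lemma M_subspace: "V.subspace M"
  using V.operator_on_subspace operator L.subspace_0[OF H_subspace] by blast

lemma shift_operator: "h \<in> H \<Longrightarrow> operator_on sm M (shift h c)"
  using V.operator_on_shift[OF operator] by (simp add: shift_def[abs_def])

lemma shift_pow_operator: "h \<in> H \<Longrightarrow> operator_on sm M (shift h c ^^ n)"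
  by (rule V.operator_on_funpow[OF shift_operator])

lemma shift_pow_commute:
  assumes "operator_on sm M B" "\<And>v. v \<in> M \<Longrightarrow> T h (B v) = B (T h v)" "h \<in> H" "v \<in> M"
  shows "(shift h c ^^ n) (B v) = B ((shift h c ^^ n) v)"
proof (rule funpow_commute_on[THEN conjunct2])
  show "shift h c v \<in> M" if "v \<in> M" for v
    using V.operator_on_closed[OF shift_operator] assms(3) that .
  show "shift h c (B v) = B (shift h c v)" if "v \<in> M" for v
    unfolding shift_def
    using that assms(2)[OF that] V.operator_onD[OF assms(1)] V.operator_on_diff[OF assms(1)]
      V.operator_on_closed[OF operator[OF assms(3)]] V.subspace_scale[OF M_subspace]
    by simp
qed fact

lemma shift_pow_shift_pow:
  assumes "h \<in> H" "h' \<in> H" "v \<in> M"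
  shows "(shift h c ^^ n) ((shift h' c' ^^ k) v) = (shift h' c' ^^ k) ((shift h c ^^ n) v)"
proof (rule shift_pow_commute[OF shift_pow_operator])
  show "T h ((shift h' c' ^^ k) v) = (shift h' c' ^^ k) (T h v)" if "v \<in> M" for v
    using shift_pow_commute[OF operator[OF assms(1)] commute[OF assms(2,1)] assms(2) that] by simp
qed (use assms in auto)

lemma weight_part_subspace: "V.subspace (weight_part \<mu>)"
proof (rule V.subspaceI)
  show "0 \<in> weight_part \<mu>"
    using V.subspace_0[OF M_subspace] by (auto simp: weight_part_def intro: exI[of _ 0])
  show "x + y \<in> weight_part \<mu>" if "x \<in> weight_part \<mu>" "y \<in> weight_part \<mu>" for x y
  proof -
    have "\<exists>n. (shift h (\<mu> h) ^^ n) (x + y) = 0" if h: "h \<in> H" for h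
    proof -
      obtain n k where "(shift h (\<mu> h) ^^ n) x = 0" "(shift h (\<mu> h) ^^ k) y = 0"
        using \<open>x \<in> _\<close> \<open>y \<in> _\<close> h unfolding weight_part_def by blast
      then have "(shift h (\<mu> h) ^^ max n k) x = 0" "(shift h (\<mu> h) ^^ max n k) y = 0"
        by (auto intro: funpow_eq_0_mono V.operator_on_0[OF shift_operator[OF h]])
      then have "(shift h (\<mu> h) ^^ max n k) (x + y) = 0"
        using V.operator_on_add[OF shift_pow_operator[OF h]] \<open>x \<in> _\<close> \<open>y \<in> _\<close>
        by (simp add: weight_part_def)
      then show ?thesis ..
    qed
    then show ?thesis
      using that V.subspace_add[OF M_subspace] by (auto simp: weight_part_def)
  qed
  show "sm c x \<in> weight_part \<mu>" if "x \<in> weight_part \<mu>" for c x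
  proof -
    have "(shift h (\<mu> h) ^^ n) (sm c x) = sm c ((shift h (\<mu> h) ^^ n) x)" if "h \<in> H" for h n
      using V.operator_on_scale[OF shift_pow_operator[OF that]] \<open>x \<in> _\<close> by (simp add: weight_part_def)
    then show ?thesis
      using that V.subspace_scale[OF M_subspace] by (fastforce simp: weight_part_def)
  qed
qed

lemma weight_part_stable:
  assumes "operator_on sm M B" "\<And>h v. h \<in> H \<Longrightarrow> v \<in> M \<Longrightarrow> T h (B v) = B (T h v)"
    and "v \<in> weight_part \<mu>"
  shows "B v \<in> weight_part \<mu>"
  unfolding weight_part_def
proof (intro CollectI conjI ballI)
  have v: "v \<in> M" using assms(3) by (simp add: weight_part_def)
  then show "B v \<in> M" by (rule V.operator_on_closed[OF assms(1)])
  fix h assume h: "h \<in> H"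
  then obtain n where "(shift h (\<mu> h) ^^ n) v = 0" using assms(3) unfolding weight_part_def by blast
  then have "(shift h (\<mu> h) ^^ n) (B v) = 0"
    using shift_pow_commute[OF assms(1) assms(2)[OF h] h v] V.operator_on_0[OF assms(1)] by simp
  then show "\<exists>n. (shift h (\<mu> h) ^^ n) (B v) = 0" ..
qed

section \<open>Eigenvalues and joint weights\<close>

lemma shift_pow_eigenvector:
  assumes "h \<in> H" "v \<in> M" "T h v = sm c v"
  shows "(shift h d ^^ n) v = sm ((c - d) ^ n) v"
proof (induction n)
  case (Suc n)
  then show ?case
    using V.operator_on_scale[OF shift_operator[OF assms(1)] assms(2)] assms(3)
    by (simp add: shift_def V.scale_left_diff_distrib[symmetric] mult.commute)
qed simp

text \<open>The power of the shift multiplies \<open>v\<close> by \<open>(c - d) ^ n\<close>, which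
  is nonzero for \<open>c \<noteq> d\<close>.\<close>

lemma eigenvalue_unique:
  assumes "h \<in> H" "v \<in> M" "T h v = sm c v" "v \<noteq> 0" "(shift h d ^^ n) v = 0"
  shows "c = d"
  using assms shift_pow_eigenvector[OF assms(1-3)] by auto

text \<open>If every operator has a single eigenvalue on a nonzero stable subspace, these eigenvalues
  depend linearly on the operator because any two of the operators share an eigenvector.\<close>

lemma single_weight:
  assumes W: "V.subspace W" "W \<subseteq> M" "\<And>h w. h \<in> H \<Longrightarrow> w \<in> W \<Longrightarrow> T h w \<in> W"
    and w0: "w0 \<in> W" "w0 \<noteq> 0"
    and single: "\<And>h. h \<in> H \<Longrightarrow> \<exists>c. \<forall>w\<in>W. \<exists>n. (shift h c ^^ n) w = 0"
  shows "\<exists>\<mu>\<in>dual sc H. W \<subseteq> weight_part \<mu>"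
proof -
  \<comment> \<open>The value 0 off \<open>H\<close> is the convention of
    \<open>dual\<close>.\<close>
  define \<mu> where "\<mu> h = (if h \<in> H then SOME c. \<forall>w\<in>W. \<exists>n. (shift h c ^^ n) w = 0 else 0)" for h
  have nil: "\<exists>n. (shift h (\<mu> h) ^^ n) w = 0" if "h \<in> H" "w \<in> W" for h w
    using someI_ex[OF single[OF that(1)]] that by (simp add: \<mu>_def)
  have stable: "(shift h c ^^ n) w \<in> W" if "h \<in> H" "w \<in> W" for h c n w
    using that W by (induction n) (auto simp: shift_def V.subspace_diff V.subspace_scale)
  \<comment> \<open>Iterating the shift of \<open>h\<close> from \<open>w0\<close> ends in an
    eigenvector \<open>w1\<close>. Iterating the shift of \<open>h'\<close> from \<open>w1\<close>
    stays in the kernel of the first shift by commutation, and ends in a common eigenvector.\<close>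
  have common: "\<exists>v\<in>W. v \<noteq> 0 \<and> T h v = sm (\<mu> h) v \<and> T h' v = sm (\<mu> h') v"
    if h: "h \<in> H" "h' \<in> H" for h h'
  proof -
    obtain k where k: "(shift h (\<mu> h) ^^ k) w0 \<noteq> 0" "shift h (\<mu> h) ((shift h (\<mu> h) ^^ k) w0) = 0"
      using nil[OF h(1) w0(1)] funpow_kernel_nonzero w0(2) by meson
    define w1 where "w1 = (shift h (\<mu> h) ^^ k) w0"
    have w1: "w1 \<in> W" "w1 \<noteq> 0" "shift h (\<mu> h) w1 = 0"
      using k stable[OF h(1) w0(1)] by (auto simp: w1_def)
    obtain l where l: "(shift h' (\<mu> h') ^^ l) w1 \<noteq> 0" "shift h' (\<mu> h') ((shift h' (\<mu> h') ^^ l) w1) = 0"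
      using nil[OF h(2) w1(1)] funpow_kernel_nonzero w1(2) by meson
    have "shift h (\<mu> h) ((shift h' (\<mu> h') ^^ l) w1) = (shift h' (\<mu> h') ^^ l) (shift h (\<mu> h) w1)"
      using shift_pow_shift_pow[OF h, where n = 1] w1(1) W(2) by auto
    then have "shift h (\<mu> h) ((shift h' (\<mu> h') ^^ l) w1) = 0"
      using w1(3) V.operator_on_0[OF shift_pow_operator[OF h(2)]] by simp
    then show ?thesis
      using l stable[OF h(2) w1(1)] by (auto simp: shift_def)
  qed
  \<comment> \<open>Any eigenvector in \<open>W\<close> determines the value of
    \<open>\<mu>\<close>. A common eigenvector of \<open>x\<close> and \<open>y\<close> is also one
    of \<open>x + y\<close>, which gives additivity below.\<close>
  have eigenvalue_of_W: "\<mu> h = c" if "h \<in> H" "v \<in> W" "v \<noteq> 0" "T h v = sm c v" for h v c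
  proof -
    have "v \<in> M" using that(2) W(2) by blast
    then show ?thesis
      using nil[OF that(1,2)] eigenvalue_unique[OF that(1) _ that(4,3)] by blast
  qed
  have "\<mu> \<in> dual sc H"
    unfolding dual_def
  proof (intro CollectI conjI ballI allI impI)
    fix x y assume xy: "x \<in> H" "y \<in> H"
    then obtain v where v: "v \<in> W" "v \<noteq> 0" "T x v = sm (\<mu> x) v" "T y v = sm (\<mu> y) v"
      using common by blast
    have "x + y \<in> H" using xy L.subspace_add[OF H_subspace] by blast
    moreover have "T (x + y) v = sm (\<mu> x + \<mu> y) v"
      using add_T[OF xy] v W(2) by (auto simp: V.scale_left_distrib)
    ultimately show "\<mu> (x + y) = \<mu> x + \<mu> y"
      using eigenvalue_of_W[OF _ v(1,2)] by simp
  next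
    fix c x assume x: "x \<in> H"
    then obtain v where v: "v \<in> W" "v \<noteq> 0" "T x v = sm (\<mu> x) v"
      using common by blast
    have "sc c x \<in> H" using x L.subspace_scale[OF H_subspace] by blast
    moreover have "T (sc c x) v = sm (c * \<mu> x) v"
      using scale_T[OF x] v W(2) by auto
    ultimately show "\<mu> (sc c x) = c * \<mu> x"
      using eigenvalue_of_W[OF _ v(1,2)] by simp
  qed (simp add: \<mu>_def)
  moreover have "W \<subseteq> weight_part \<mu>" using nil W(2) by (auto simp: weight_part_def)
  ultimately show ?thesis by blast
qed

lemma finite_dim_weight_decomposition:
  assumes "V.subspace W" "W \<subseteq> M" "\<And>h w. h \<in> H \<Longrightarrow> w \<in> W \<Longrightarrow> T h w \<in> W"
    and "W \<subseteq> V.span B" "finite B"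
  shows "W \<subseteq> V.span (\<Union>\<mu>\<in>dual sc H. weight_part \<mu>)"
  using assms(1-4)
proof (induction "V.dim W" arbitrary: W rule: less_induct)
  case (less W)
  let ?S = "V.span (\<Union>\<mu>\<in>dual sc H. weight_part \<mu>)"
  consider "W \<subseteq> {0}"
    | w0 where "w0 \<in> W" "w0 \<noteq> 0" "\<forall>h\<in>H. \<exists>c. \<forall>w\<in>W. \<exists>n. (shift h c ^^ n) w = 0"
    | w0 h where "w0 \<in> W" "w0 \<noteq> 0" "h \<in> H" "\<forall>c. \<exists>w\<in>W. \<forall>n. (shift h c ^^ n) w \<noteq> 0"
  proof (cases "W \<subseteq> {0}")
    case False
    then obtain w0 where "w0 \<in> W" "w0 \<noteq> 0" by blast
    then show thesis
      using that(2,3)[of w0] by (cases "\<forall>h\<in>H. \<exists>c. \<forall>w\<in>W. \<exists>n. (shift h c ^^ n) w = 0") blast+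
  qed
  then show ?case
  proof cases
    case 1
    then show ?thesis using V.span_zero by blast
  next
    case 2
    then obtain \<mu> where "\<mu> \<in> dual sc H" "W \<subseteq> weight_part \<mu>"
      using single_weight[OF less.prems(1-3)] by blast
    then show ?thesis using V.span_superset by blast
  next
    case 3
    have opW: "operator_on sm W (shift h c)" for c
      by (rule V.operator_on_subset[OF shift_operator])
        (use less.prems 3 in \<open>auto simp: shift_def V.subspace_diff V.subspace_scale\<close>)
    have "operator_on sm W (T h)"
      using V.operator_on_subset[OF operator] less.prems 3(3) by blast
    then obtain c v where cv: "v \<in> W" "v \<noteq> 0" "T h v = sm c v"
      using ex_eigenvector[OF V.vector_space_axioms _ less.prems(4) assms(5) 3(1,2)] by blast
    define A where "A = shift h c"
    have A: "operator_on sm W A" unfolding A_def by (rule opW)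
    obtain n where n: "n > 0" "\<And>v. v \<in> W \<Longrightarrow> \<exists>u\<in>W. (A ^^ n) (v - (A ^^ n) u) = 0"
      using V.fitting_decomposition[OF A less.prems(4) assms(5)] by blast
    note An = V.operator_on_funpow[OF A, of n]
    \<comment> \<open>Commutation makes both Fitting pieces stable under every operator of the
      family, not only under \<open>T h\<close>.\<close>
    have TA: "T h' ((A ^^ n) w) = (A ^^ n) (T h' w)" if "h' \<in> H" "w \<in> W" for h' w
    proof -
      have "w \<in> M" using that(2) less.prems(2) by blast
      then show ?thesis
        unfolding A_def
        using shift_pow_commute[OF operator[OF that(1)] commute[OF 3(3) that(1)] 3(3)] by simp
    qed
    define W0 where "W0 = {w \<in> W. (A ^^ n) w = 0}"
    define W1 where "W1 = (A ^^ n) ` W"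
    have W0: "V.subspace W0" "W0 \<subseteq> W" "\<And>h w. h \<in> H \<Longrightarrow> w \<in> W0 \<Longrightarrow> T h w \<in> W0"
      using V.subspace_kernel_on[OF An] less.prems(3) TA[symmetric]
        V.operator_on_0[OF operator]
      by (auto simp: W0_def)
    have W1: "V.subspace W1" "W1 \<subseteq> W" "\<And>h w. h \<in> H \<Longrightarrow> w \<in> W1 \<Longrightarrow> T h w \<in> W1"
      using V.subspace_image_on[OF An] V.operator_on_closed[OF An] less.prems(3) TA
      by (auto simp: W1_def)
    \<comment> \<open>The operator of \<open>h\<close> has no single eigenvalue on \<open>W\<close>,
      so some vector survives all powers of the shift by \<open>c\<close>.\<close>
    have "W0 \<noteq> W" using 3(4) unfolding W0_def A_def by blast
    \<comment> \<open>If the image were all of \<open>W\<close>, then by \<open>n > 0\<close> also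
      \<open>A\<close> would be surjective on \<open>W\<close>, hence injective, against the
      eigenvector \<open>v\<close>.\<close>
    moreover have "W1 \<noteq> W"
    proof
      assume eq: "W1 = W"
      obtain n' where "n = Suc n'" using n(1) by (cases n) auto
      then have "W1 \<subseteq> A ` W"
        using V.operator_on_closed[OF V.operator_on_funpow[OF A]] by (auto simp: W1_def)
      then have "A ` W = W" using eq V.operator_on_closed[OF A] by blast
      then have "v = 0"
        using V.injective_if_surjective_on[OF A less.prems(4) assms(5)] cv by (simp add: A_def shift_def)
      with cv show False by simp
    qed
    ultimately have dims: "V.dim W0 < V.dim W" "V.dim W1 < V.dim W"
      using V.dim_psubset_subspace W0 W1 less.prems(4) assms(5) by (metis psubsetI)+
    have IH: "W0 \<subseteq> ?S" "W1 \<subseteq> ?S"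
      using less.hyps[OF dims(1) W0(1) _ W0(3)] less.hyps[OF dims(2) W1(1) _ W1(3)]
        W0(2) W1(2) less.prems(2,4) by (meson order_trans)+
    show ?thesis
    proof
      fix w assume w: "w \<in> W"
      then obtain u where u: "u \<in> W" "(A ^^ n) (w - (A ^^ n) u) = 0" using n(2) by blast
      then have "w - (A ^^ n) u \<in> W0" "(A ^^ n) u \<in> W1"
        using w W1(2) V.subspace_diff[OF less.prems(1)] by (auto simp: W0_def W1_def)
      then have "(w - (A ^^ n) u) + (A ^^ n) u \<in> ?S" using IH V.span_add by blast
      then show "w \<in> ?S" by simp
    qed
  qed
qed

text \<open>A power \<open>B\<close> of the shift by \<open>\<mu> h\<close> kills
  \<open>f \<mu>\<close> and preserves the other weight parts, so the induction hypothesis gives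
  \<open>B x = 0\<close>. A nonzero \<open>x\<close> would then have a last nonzero iterate with
  both eigenvalues \<open>\<mu> h\<close> and \<open>\<nu> h\<close>.\<close>

lemma weight_parts_independent:
  assumes "finite F" "F \<subseteq> dual sc H" "\<nu> \<in> dual sc H" "\<nu> \<notin> F"
    and "x \<in> weight_part \<nu>" "\<And>\<kappa>. \<kappa> \<in> F \<Longrightarrow> f \<kappa> \<in> weight_part \<kappa>" "x = (\<Sum>\<kappa>\<in>F. f \<kappa>)"
  shows "x = 0"
  using assms
proof (induction F arbitrary: x f rule: finite_induct)
  case (insert \<mu> F)
  obtain h where h: "h \<in> H" "\<mu> h \<noteq> \<nu> h"
    using dual_neq_obtains[of \<mu> sc H \<nu>] insert.prems(1-3) by auto
  obtain n where n: "(shift h (\<mu> h) ^^ n) (f \<mu>) = 0"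
    using insert.prems(5)[of \<mu>] h by (auto simp: weight_part_def)
  define B where "B = shift h (\<mu> h) ^^ n"
  have B: "operator_on sm M B" unfolding B_def by (rule shift_pow_operator[OF h(1)])
  have "T h' (B v) = B (T h' v)" if "h' \<in> H" "v \<in> M" for h' v
    using shift_pow_commute[OF operator[OF that(1)] _ h(1) that(2)] commute that(1) h(1) by (simp add: B_def)
  note stable = weight_part_stable[OF B this]
  have fM: "f \<kappa> \<in> M" if "\<kappa> \<in> insert \<mu> F" for \<kappa>
    using insert.prems(5)[OF that] by (simp add: weight_part_def)
  have "B x = (\<Sum>\<kappa>\<in>insert \<mu> F. B (f \<kappa>))"
    unfolding insert.prems(6) by (rule V.operator_on_sum[OF B fM])
  also have "\<dots> = (\<Sum>\<kappa>\<in>F. B (f \<kappa>))" using insert.hyps n by (simp add: B_def)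
  finally have sum: "B x = (\<Sum>\<kappa>\<in>F. B (f \<kappa>))" .
  have Bx: "B x = 0"
    by (rule insert.IH[OF _ _ _ _ _ sum])
      (use insert.prems(1-3) in \<open>auto intro: stable insert.prems(4,5)\<close>)
  show ?case
  proof (rule ccontr)
    assume "x \<noteq> 0"
    have xM: "x \<in> M" using insert.prems(4) by (simp add: weight_part_def)
    obtain k where k: "(shift h (\<mu> h) ^^ k) x \<noteq> 0" "shift h (\<mu> h) ((shift h (\<mu> h) ^^ k) x) = 0"
      using funpow_kernel_nonzero[OF Bx[unfolded B_def] \<open>x \<noteq> 0\<close>] by blast
    obtain l where "(shift h (\<nu> h) ^^ l) x = 0"
      using insert.prems(4) h by (auto simp: weight_part_def)
    then have "(shift h (\<nu> h) ^^ l) ((shift h (\<mu> h) ^^ k) x) = 0"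
      using shift_pow_shift_pow[OF h(1) h(1) xM] V.operator_on_0[OF shift_pow_operator[OF h(1)]] by simp
    moreover have "T h ((shift h (\<mu> h) ^^ k) x) = sm (\<mu> h) ((shift h (\<mu> h) ^^ k) x)"
      using k(2) by (simp add: shift_def)
    ultimately have "\<mu> h = \<nu> h"
      using eigenvalue_unique[OF h(1)] k(1) V.operator_on_closed[OF shift_pow_operator[OF h(1)] xM]
      by blast
    with h show False by simp
  qed
qed simp

end

section \<open>Direct sums of submodules\<close>

text \<open>The condition under the unique existence in \<open>internal_direct_sum\<close>, named so
  that families of components can be added, scaled and mapped. Vanishing off \<open>I\<close> makes
  uniqueness of \<open>c\<close> as a total function possible.\<close>

definition decomposes_as ::
  "'i set \<Rightarrow> ('i \<Rightarrow> 'm::ab_group_add set) \<Rightarrow> ('i \<Rightarrow> 'm) \<Rightarrow> 'm \<Rightarrow> bool" where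
  "decomposes_as I D c m \<longleftrightarrow>
     (\<forall>i\<in>I. c i \<in> D i) \<and> (\<forall>i. i \<notin> I \<longrightarrow> c i = 0) \<and> finite {i. c i \<noteq> 0} \<and>
     m = (\<Sum>i | c i \<noteq> 0. c i)"

lemma internal_direct_sum_iff:
  "internal_direct_sum I D M \<longleftrightarrow> (\<forall>i\<in>I. D i \<subseteq> M) \<and> (\<forall>m\<in>M. \<exists>!c. decomposes_as I D c m)"
  by (simp add: internal_direct_sum_def decomposes_as_def)

lemma decomposes_as_sum:
  assumes "decomposes_as I D c m" "finite F" "{i. c i \<noteq> 0} \<subseteq> F"
  shows "m = (\<Sum>i\<in>F. c i)"
proof -
  have "(\<Sum>i | c i \<noteq> 0. c i) = (\<Sum>i\<in>F. c i)"
    using assms by (intro sum.mono_neutral_left) auto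
  with assms(1) show ?thesis by (simp add: decomposes_as_def)
qed

lemma decomposes_asI:
  assumes "\<And>i. i \<in> I \<Longrightarrow> c i \<in> D i" "\<And>i. i \<notin> I \<Longrightarrow> c i = 0"
    and "finite F" "{i. c i \<noteq> 0} \<subseteq> F" "m = (\<Sum>i\<in>F. c i)"
  shows "decomposes_as I D c m"
proof -
  have "(\<Sum>i | c i \<noteq> 0. c i) = (\<Sum>i\<in>F. c i)"
    using assms by (intro sum.mono_neutral_left) auto
  with assms show ?thesis by (auto simp: decomposes_as_def intro: finite_subset)
qed

lemma decomposes_as_single:
  assumes "\<And>j. j \<in> I \<Longrightarrow> 0 \<in> D j" "i \<in> I" "m \<in> D i"
  shows "decomposes_as I D (\<lambda>j. if j = i then m else 0) m"
  by (rule decomposes_asI[where F = "{i}"]) (use assms in auto)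

context vector_space
begin

lemma decomposes_as_add:
  assumes "\<And>i. i \<in> I \<Longrightarrow> subspace (D i)" "decomposes_as I D c m" "decomposes_as I D c' m'"
  shows "decomposes_as I D (\<lambda>i. c i + c' i) (m + m')"
proof (rule decomposes_asI)
  let ?F = "{i. c i \<noteq> 0} \<union> {i. c' i \<noteq> 0}"
  show fin: "finite ?F" using assms(2,3) by (simp add: decomposes_as_def)
  show "m + m' = (\<Sum>i\<in>?F. c i + c' i)"
    using decomposes_as_sum[OF assms(2) fin] decomposes_as_sum[OF assms(3) fin]
    by (simp add: sum.distrib)
qed (use assms in \<open>auto simp: decomposes_as_def subspace_add\<close>)

text \<open>Since \<open>f\<close> preserves each summand, the images of the components are
  components again. Here \<open>f\<close> will be the action of a Lie algebra element or a
  homothety.\<close>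

lemma decomposes_as_image:
  assumes "operator_on scale M f" "\<And>i. i \<in> I \<Longrightarrow> D i \<subseteq> M"
    and "\<And>i v. i \<in> I \<Longrightarrow> v \<in> D i \<Longrightarrow> f v \<in> D i" "decomposes_as I D c m"
  shows "decomposes_as I D (\<lambda>i. f (c i)) (f m)"
proof (rule decomposes_asI)
  let ?F = "{i. c i \<noteq> 0}"
  show "finite ?F" using assms(4) by (simp add: decomposes_as_def)
  have "c i \<in> M" for i
    using assms(2,4) subspace_0[OF operator_on_subspace[OF assms(1)]]
    by (cases "i \<in> I") (auto simp: decomposes_as_def)
  then show "f m = (\<Sum>i\<in>?F. f (c i))"
    using operator_on_sum[OF assms(1), of ?F c] assms(4) by (simp add: decomposes_as_def)
  show "{i. f (c i) \<noteq> 0} \<subseteq> ?F" using operator_on_0[OF assms(1)] by auto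
qed (use assms(3,4) operator_on_0[OF assms(1)] in \<open>auto simp: decomposes_as_def\<close>)

lemma operator_on_homothety: "subspace M \<Longrightarrow> operator_on scale M (scale a)"
  by (auto simp: operator_on_def subspace_scale scale_right_distrib mult.commute)

lemma decomposes_as_scale:
  assumes "\<And>i. i \<in> I \<Longrightarrow> subspace (D i)" "decomposes_as I D c m"
  shows "decomposes_as I D (\<lambda>i. scale a (c i)) (scale a m)"
proof (rule decomposes_as_image[OF operator_on_homothety[OF subspace_UNIV] _ _ assms(2)])
  show "scale a v \<in> D i" if "i \<in> I" "v \<in> D i" for i v
    using subspace_scale[OF assms(1)] that by blast
qed simp

text \<open>The decomposable vectors form a subspace containing every summand. Uniqueness is a
  separate matter, settled by independence of the weight parts.\<close>

lemma span_Union_decomposes: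
  assumes "\<And>i. i \<in> I \<Longrightarrow> subspace (D i)" "m \<in> span (\<Union>i\<in>I. D i)"
  shows "\<exists>c. decomposes_as I D c m"
proof (rule span_induct[OF assms(2)])
  show "subspace {m. \<exists>c. decomposes_as I D c m}"
  proof (rule subspaceI)
    have "decomposes_as I D (\<lambda>_. 0) 0"
      using assms(1) subspace_0 by (simp add: decomposes_as_def)
    then show "0 \<in> {m. \<exists>c. decomposes_as I D c m}" by blast
    show "x + y \<in> {m. \<exists>c. decomposes_as I D c m}"
      if "x \<in> {m. \<exists>c. decomposes_as I D c m}" "y \<in> {m. \<exists>c. decomposes_as I D c m}" for x y
      using that by (auto intro: decomposes_as_add[OF assms(1)])
    show "scale a x \<in> {m. \<exists>c. decomposes_as I D c m}" if "x \<in> {m. \<exists>c. decomposes_as I D c m}" for a x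
      using that by (auto intro: decomposes_as_scale[OF assms(1)])
  qed
next
  fix x assume "x \<in> (\<Union>i\<in>I. D i)"
  then obtain i where "i \<in> I" "x \<in> D i" by blast
  then show "\<exists>c. decomposes_as I D c x"
    using decomposes_as_single[of I D] assms(1) subspace_0 by blast
qed

end

section \<open>Submodules, and projections onto the summands of a module\<close>

context lie_module
begin

lemma act_operator: "operator_on sm M (act x)"
  using carrier_subspace act_closed act_add act_scale by (simp add: operator_on_def)

lemma submodule:
  assumes "V.subspace N" "N \<subseteq> M" "\<And>x v. v \<in> N \<Longrightarrow> act x v \<in> N"
  shows "lie_module sc bracket sm act N"
  by unfold_locales
    (use assms act_add act_scale add_act scale_act bracket_act in \<open>auto simp: subset_eq\<close>)

end

locale module_decomposition = lie_module sc bracket sm act M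
  for sc :: "complex \<Rightarrow> 'l::ab_group_add \<Rightarrow> 'l"
    and bracket :: "'l \<Rightarrow> 'l \<Rightarrow> 'l"
    and sm :: "complex \<Rightarrow> 'm::ab_group_add \<Rightarrow> 'm"
    and act :: "'l \<Rightarrow> 'm \<Rightarrow> 'm"
    and M :: "'m set" +
  fixes I :: "'i set" and D :: "'i \<Rightarrow> 'm set"
  assumes summand_subspace: "i \<in> I \<Longrightarrow> V.subspace (D i)"
    and summand_closed: "i \<in> I \<Longrightarrow> v \<in> D i \<Longrightarrow> act x v \<in> D i"
    and direct_sum: "internal_direct_sum I D M"
begin

definition component :: "'i \<Rightarrow> 'm \<Rightarrow> 'm" where
  "component i m = (THE c. decomposes_as I D c m) i"

lemma summand_subset: "i \<in> I \<Longrightarrow> D i \<subseteq> M"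
  using direct_sum by (simp add: internal_direct_sum_iff)

lemma component_decomposes: "m \<in> M \<Longrightarrow> decomposes_as I D (\<lambda>i. component i m) m"
  unfolding component_def using direct_sum
  by (intro theI'[of "\<lambda>c. decomposes_as I D c m", simplified]) (simp add: internal_direct_sum_iff)

text \<open>Uniqueness lets any explicit decomposing family be recognized as the components;
  linearity and equivariance of the projections follow from it.\<close>

lemma component_eqI:
  assumes "m \<in> M" "decomposes_as I D c m"
  shows "component i m = c i"
  using component_decomposes[OF assms(1)] assms direct_sum
  by (metis internal_direct_sum_iff)

lemma component_in_summand: "i \<in> I \<Longrightarrow> m \<in> M \<Longrightarrow> component i m \<in> D i"
  using component_decomposes by (simp add: decomposes_as_def)

lemma component_add: "m \<in> M \<Longrightarrow> m' \<in> M \<Longrightarrow> component i (m + m') = component i m + component i m'"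
  using V.decomposes_as_add[OF summand_subspace component_decomposes component_decomposes]
    component_eqI V.subspace_add[OF carrier_subspace] by blast

lemma component_scale: "m \<in> M \<Longrightarrow> component i (sm a m) = sm a (component i m)"
  using V.decomposes_as_scale[OF summand_subspace component_decomposes]
    component_eqI V.subspace_scale[OF carrier_subspace] by blast

lemma component_act: "m \<in> M \<Longrightarrow> component i (act x m) = act x (component i m)"
  using V.decomposes_as_image[OF act_operator summand_subset summand_closed component_decomposes]
    component_eqI act_closed by blast

lemma component_0: "component i 0 = 0"
  using component_scale[of 0 i 0] V.subspace_0[OF carrier_subspace] by simp

lemma component_of_summand: "i \<in> I \<Longrightarrow> m \<in> D i \<Longrightarrow> component i m = m"
  using component_eqI[OF _ decomposes_as_single[of I D i m], of i] summand_subset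
    V.subspace_0[OF summand_subspace] by auto

text \<open>The preimage of \<open>X\<close> under the projection is a subspace. As the projection
  is linear only on \<open>M\<close>, the span induction has to carry membership in \<open>M\<close>
  along.\<close>

lemma component_span:
  assumes "V.subspace X" "S \<subseteq> M" "m \<in> V.span S" "\<And>s. s \<in> S \<Longrightarrow> component i s \<in> X"
  shows "component i m \<in> X"
proof -
  have "m \<in> {m \<in> M. component i m \<in> X}"
  proof (rule V.span_induct[OF assms(3)])
    show "V.subspace {m. m \<in> {m \<in> M. component i m \<in> X}}"
      using assms(1) carrier_subspace
      by (auto simp: V.subspace_def component_0 component_add component_scale)
  qed (use assms in auto)
  then show ?thesis by simp
qed

lemma monomials_carrier: "S \<subseteq> M \<Longrightarrow> v \<in> monomials act A S \<Longrightarrow> v \<in> M"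
  by (rotate_tac, induction rule: monomials.induct) (auto intro: act_closed)

lemma component_monomial:
  assumes "v \<in> monomials act A S" "S \<subseteq> M"
  shows "component i v \<in> monomials act A (component i ` S)"
  using assms
proof (induction rule: monomials.induct)
  case (step x v)
  then show ?case
    using component_act[OF monomials_carrier[OF step.prems step.hyps(2)]] by (auto intro: monomials.step)
qed (auto intro: monomials.gen)

text \<open>The projections of the generators generate, since the projection commutes with the
  action and fixes \<open>D i\<close>.\<close>

lemma finitely_generated_summand:
  assumes "finitely_generated sm act M" "i \<in> I"
  shows "finitely_generated sm act (D i)"
proof -
  obtain S where S: "finite S" "S \<subseteq> M" "env_span sm act UNIV S = M"
    using assms(1) by (auto simp: finitely_generated_def)
  have sub: "component i ` S \<subseteq> D i" using component_in_summand[OF assms(2)] S(2) by auto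
  have "v \<in> D i" if "v \<in> monomials act UNIV (component i ` S)" for v
    using that by induction (use sub summand_closed[OF assms(2)] in auto)
  then have "env_span sm act UNIV (component i ` S) \<subseteq> D i"
    unfolding env_span_def using summand_subspace[OF assms(2)] by (intro V.span_minimal) auto
  moreover have "D i \<subseteq> env_span sm act UNIV (component i ` S)"
  proof
    fix d assume d: "d \<in> D i"
    then have "d \<in> V.span (monomials act UNIV S)"
      using S(3) summand_subset[OF assms(2)] by (auto simp: env_span_def)
    then have "component i d \<in> env_span sm act UNIV (component i ` S)"
      unfolding env_span_def
      by (rule component_span[OF V.subspace_span, rotated])
        (use S(2) in \<open>auto intro: monomials_carrier V.span_base component_monomial\<close>)
    then show "d \<in> env_span sm act UNIV (component i ` S)"
      using component_of_summand[OF assms(2) d] by simp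
  qed
  ultimately show ?thesis
    using S(1) sub unfolding finitely_generated_def by blast
qed

text \<open>Each of the finitely many generators has finitely many nonzero components. At an index
  where all of them have component zero, equivariance makes the projection vanish on
  \<open>M\<close>, yet it is the identity on \<open>D i\<close>.\<close>

lemma finite_nonzero_summands:
  assumes "finitely_generated sm act M"
  shows "finite {i \<in> I. D i \<noteq> {0}}"
proof -
  obtain S where S: "finite S" "S \<subseteq> M" "env_span sm act UNIV S = M"
    using assms(1) by (auto simp: finitely_generated_def)
  have "finite (\<Union>s\<in>S. {i. component i s \<noteq> 0})"
    using S component_decomposes by (auto simp: decomposes_as_def)
  moreover have "D i = {0}" if i: "i \<in> I" "i \<notin> (\<Union>s\<in>S. {i. component i s \<noteq> 0})" for i
  proof -
    have "component i v \<in> {0}" if "v \<in> monomials act UNIV S" for v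
      using that
    proof induction
      case (step x v)
      then show ?case
        using component_act[OF monomials_carrier[OF S(2) step.hyps(2)]] V.operator_on_0[OF act_operator]
        by simp
    qed (use i in auto)
    then have "component i m \<in> {0}" if "m \<in> M" for m
      by (rule component_span[OF V.subspace_single_0 _ that[folded S(3), unfolded env_span_def], rotated])
        (use S(2) in \<open>auto intro: monomials_carrier\<close>)
    then have "D i \<subseteq> {0}"
      using component_of_summand[OF i(1)] summand_subset[OF i(1)] by fastforce
    then show ?thesis using V.subspace_0[OF summand_subspace[OF i(1)]] by blast
  qed
  then have "{i \<in> I. D i \<noteq> {0}} \<subseteq> (\<Union>s\<in>S. {i. component i s \<noteq> 0})" by blast
  ultimately show ?thesis by (rule finite_subset[rotated])
qed

text \<open>By equivariance the projection of a weight vector satisfies the same eigenvalue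
  equations. The map \<open>g\<close> will be the embedding of \<open>h\<close> as
  \<open>(h, 0)\<close>.\<close>

lemma spanned_by_eigenvectors_summand:
  assumes "M = V.span {m \<in> M. \<exists>\<nu>\<in>N. \<forall>h\<in>K. act (g h) m = sm (\<nu> h) m}" "i \<in> I"
  shows "D i = V.span {m \<in> D i. \<exists>\<nu>\<in>N. \<forall>h\<in>K. act (g h) m = sm (\<nu> h) m}" (is "_ = V.span ?E")
proof
  show "V.span ?E \<subseteq> D i" using summand_subspace[OF assms(2)] by (intro V.span_minimal) auto
  show "D i \<subseteq> V.span ?E"
  proof
    fix d assume d: "d \<in> D i"
    have "component i d \<in> V.span ?E"
    proof (rule component_span[OF V.subspace_span])
      show "d \<in> V.span {m \<in> M. \<exists>\<nu>\<in>N. \<forall>h\<in>K. act (g h) m = sm (\<nu> h) m}"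
        using assms(1) d summand_subset[OF assms(2)] by blast
      show "component i s \<in> V.span ?E"
        if "s \<in> {m \<in> M. \<exists>\<nu>\<in>N. \<forall>h\<in>K. act (g h) m = sm (\<nu> h) m}" for s
      proof (rule V.span_base)
        from that obtain \<nu> where \<nu>: "s \<in> M" "\<nu> \<in> N" "\<And>h. h \<in> K \<Longrightarrow> act (g h) s = sm (\<nu> h) s"
          by blast
        then have "act (g h) (component i s) = sm (\<nu> h) (component i s)" if "h \<in> K" for h
          using that component_act[OF \<nu>(1)] component_scale[OF \<nu>(1)] by metis
        then show "component i s \<in> ?E"
          using \<nu>(1,2) component_in_summand[OF assms(2)] by blast
      qed
    qed auto
    then show "d \<in> V.span ?E" using component_of_summand[OF assms(2) d] by simp
  qed
qed

end

section \<open>The decomposition of category O\<close>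

text \<open>Since \<open>\<epsilon>\<^sup>2 = 0\<close>, the bracket of \<open>(0, h)\<close> with any element commutes with \<open>(0, h)\<close>. Hence
  \<open>ad (0, h)\<close> squares to zero, and one extra power of \<open>(0, h) - c\<close> absorbs the action of any element.\<close>

lemma takiff_shift_pow_act:
  assumes "lie_module (takiff_scale sc) (takiff_bracket bracket) sm act M" "lie_algebra sc bracket"
  defines "A \<equiv> \<lambda>h c v. act (0, h) v - sm c v"
  assumes "m \<in> M" "(A h c ^^ n) m = 0"
  shows "(A h c ^^ Suc n) (act x m) = 0"
proof -
  interpret lie_module "takiff_scale sc" "takiff_bracket bracket" sm act M by fact
  interpret g: lie_algebra sc bracket by fact
  have bracket_0: "bracket 0 y = 0" "bracket y 0 = 0" for y
    using g.bracket_scale_left[of 0 0 y] g.bracket_scale_right[of y 0 0] by simp_all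
  have opA: "operator_on sm M (A h c)"
    unfolding A_def by (rule V.operator_on_shift[OF act_operator])
  \<comment> \<open>This is \<open>(0, bracket h (fst x))\<close>, an element of the epsilon part,
    and so it commutes with \<open>(0, h)\<close>.\<close>
  define y where "y = takiff_bracket bracket (0, h) x"
  have "takiff_bracket bracket (0, h) y = 0"
    by (simp add: y_def takiff_bracket_def bracket_0 zero_prod_def)
  moreover have "act 0 v = 0" if "v \<in> M" for v
    using scale_act[OF that, of 0 0] by simp
  ultimately have y_comm: "act (0, h) (act y v) = act y (act (0, h) v)" if "v \<in> M" for v
    using bracket_act[OF that, of "(0, h)" y] that by simp
  have A_act: "A h c (act z v) = act z (A h c v) + (act (0, h) (act z v) - act z (act (0, h) v))"
    if "v \<in> M" for v z
    using V.operator_on_diff[OF act_operator act_closed[OF that] V.subspace_scale[OF carrier_subspace that]]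
      act_scale[OF that] by (simp add: A_def)
  have A_pow_y: "(A h c ^^ k) (act y v) = act y ((A h c ^^ k) v)" if "v \<in> M" for v k
    using funpow_commute_on[of M "A h c" "act y" v k] V.operator_on_closed[OF opA] A_act[of _ y]
      y_comm that by simp
  show ?thesis
    using assms(4,5)
  proof (induction n arbitrary: m)
    case 0
    then show ?case using V.operator_on_0[OF act_operator] V.operator_on_0[OF opA] by simp
  next
    case (Suc n)
    have Am: "A h c m \<in> M" using V.operator_on_closed[OF opA Suc.prems(1)] .
    have "(A h c ^^ Suc (Suc n)) (act x m) = (A h c ^^ Suc n) (A h c (act x m))"
      by (simp only: funpow_Suc_right o_apply)
    \<comment> \<open>Moving the shift past \<open>x\<close> costs the term \<open>act y m\<close>.
      The first term falls to the induction hypothesis at \<open>A h c m\<close>, whose exponent is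
      one lower; in the second the whole power passes through \<open>y\<close> and kills
      \<open>m\<close>.\<close>
    also have "A h c (act x m) = act x (A h c m) + act y m"
      using A_act[OF Suc.prems(1), of x] bracket_act[OF Suc.prems(1), of "(0, h)" x]
      by (simp add: y_def)
    also have "(A h c ^^ Suc n) \<dots> = (A h c ^^ Suc n) (act x (A h c m)) + act y ((A h c ^^ Suc n) m)"
      using V.operator_on_add[OF V.operator_on_funpow[OF opA] act_closed[OF Am] act_closed[OF Suc.prems(1)]]
        A_pow_y[OF Suc.prems(1), of "Suc n"] by (simp only:)
    also have "(A h c ^^ Suc n) (act x (A h c m)) = 0"
      using Suc.prems(2) by (intro Suc.IH[OF Am]) (simp only: funpow_Suc_right o_apply)
    also have "(A h c ^^ Suc n) m = 0" by (rule Suc.prems(2))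
    finally show ?case using V.operator_on_0[OF act_operator] by simp
  qed
qed

lemma gen_weight_space_act:
  assumes "lie_module (takiff_scale sc) (takiff_bracket bracket) sm act M" "lie_algebra sc bracket"
    and "m \<in> gen_weight_space H sm act M \<mu>"
  shows "act x m \<in> gen_weight_space H sm act M \<mu>"
  using assms(3) takiff_shift_pow_act[OF assms(1,2), of m] lie_module.act_closed[OF assms(1)]
  unfolding gen_weight_space_def by blast

lemma acts_locally_finitely_subset:
  "acts_locally_finitely sm act A M \<Longrightarrow> N \<subseteq> M \<Longrightarrow> acts_locally_finitely sm act A N"
  by (auto simp: acts_locally_finitely_def)

text \<open>The bracket of two elements of the epsilon part is a multiple of epsilon squared, hence
  zero.\<close>

lemma commuting_operators_takiff:
  assumes "lie_module (takiff_scale sc) (takiff_bracket bracket) sm act M" "lie_algebra sc bracket"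
    and "module.subspace sc H"
  shows "commuting_operators sc sm H M (\<lambda>h. act (0, h))"
proof -
  interpret lie_module "takiff_scale sc" "takiff_bracket bracket" sm act M by fact
  interpret g: lie_algebra sc bracket by fact
  have bracket_0: "bracket 0 y = 0" "bracket y 0 = 0" for y
    using g.bracket_scale_left[of 0 0 y] g.bracket_scale_right[of y 0 0] by simp_all
  have act_0: "act 0 v = 0" if "v \<in> M" for v
    using scale_act[OF that, of 0 0] by simp
  show ?thesis
  proof
    show "operator_on sm M (act (0, h))" for h by (rule act_operator)
    show "act (0, h + h') m = act (0, h) m + act (0, h') m" if "m \<in> M" for h h' m
      using add_act[OF that, of "(0, h)" "(0, h')"] by simp
    show "act (0, sc c h) m = sm c (act (0, h) m)" if "m \<in> M" for c h m
      using scale_act[OF that, of c "(0, h)"] by (simp add: takiff_scale_def)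
    show "act (0, h) (act (0, h') m) = act (0, h') (act (0, h) m)" if "m \<in> M" for h h' m
      using bracket_act[OF that, of "(0, h)" "(0, h')"] act_0[OF that]
      by (simp add: takiff_bracket_def bracket_0 zero_prod_def)
  qed (fact assms(3))
qed

section \<open>The weight decomposition of one object of category O\<close>

context
  fixes sc :: "complex \<Rightarrow> 'g::ab_group_add \<Rightarrow> 'g" and bracket :: "'g \<Rightarrow> 'g \<Rightarrow> 'g" and H :: "'g set"
    and P :: "('g \<Rightarrow> complex) set"
    and sm :: "complex \<Rightarrow> 'm::ab_group_add \<Rightarrow> 'm" and act :: "'g \<times> 'g \<Rightarrow> 'm \<Rightarrow> 'm" and M :: "'m set"
  assumes lie_alg: "lie_algebra sc bracket" and H: "module.subspace sc H"
    and O: "category_O sc bracket H P sm act M"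
begin

lemma O_lie_module: "lie_module (takiff_scale sc) (takiff_bracket bracket) sm act M"
  using O by (simp add: category_O_def)

interpretation lie_module "takiff_scale sc" "takiff_bracket bracket" sm act M
  by (rule O_lie_module)

interpretation hbar: commuting_operators sc sm H M "\<lambda>h. act (0, h)"
  by (rule commuting_operators_takiff[OF O_lie_module lie_alg H])

abbreviation "weight_summand \<equiv> gen_weight_space H sm act M"

lemma weight_summand_eq: "weight_summand \<mu> = hbar.weight_part \<mu>"
  by (simp add: gen_weight_space_def hbar.weight_part_def hbar.shift_def[abs_def])

lemma weight_summand_subset: "weight_summand \<mu> \<subseteq> M"
  by (auto simp: gen_weight_space_def)

lemma weight_summand_subspace: "V.subspace (weight_summand \<mu>)"
  unfolding weight_summand_eq by (rule hbar.weight_part_subspace)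

text \<open>Each \<open>m\<close> lies in the subspace that it generates under the elements
  \<open>(0, h)\<close>; local finiteness puts this stable subspace into a finite span.\<close>

lemma carrier_spanned: "M \<subseteq> V.span (\<Union>\<mu>\<in>dual sc H. weight_summand \<mu>)"
proof
  fix m assume m: "m \<in> M"
  let ?W = "env_span sm act ({0} \<times> H) {m}"
  obtain B where B: "finite B" "?W \<subseteq> V.span B"
    using O m by (auto simp: category_O_def acts_locally_finitely_def)
  have mono: "v \<in> M" if "v \<in> monomials act ({0} \<times> H) {m}" for v
    using that by induction (use m act_closed in auto)
  then have WM: "?W \<subseteq> M"
    unfolding env_span_def by (intro V.span_minimal carrier_subspace) auto
  have stable: "act (0, h) w \<in> ?W" if h: "h \<in> H" and w: "w \<in> ?W" for h w
  proof -
    have "w \<in> {w \<in> M. act (0, h) w \<in> ?W}"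
    proof (rule V.span_induct[OF w[unfolded env_span_def]])
      show "V.subspace {w. w \<in> {w \<in> M. act (0, h) w \<in> ?W}}"
        using carrier_subspace V.subspace_span[of "monomials act ({0} \<times> H) {m}"]
          V.operator_on_0[OF act_operator]
        by (auto simp: V.subspace_def act_add act_scale env_span_def)
      show "w \<in> {w \<in> M. act (0, h) w \<in> ?W}" if "w \<in> monomials act ({0} \<times> H) {m}" for w
        using that h mono by (auto simp: env_span_def intro!: V.span_base monomials.step)
    qed
    then show ?thesis by simp
  qed
  have "V.subspace ?W" by (simp add: env_span_def)
  then have "?W \<subseteq> V.span (\<Union>\<mu>\<in>dual sc H. weight_summand \<mu>)"
    using hbar.finite_dim_weight_decomposition[OF _ WM stable B(2,1)] weight_summand_eq by simp
  moreover have "m \<in> ?W" by (auto simp: env_span_def intro: V.span_base monomials.gen)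
  ultimately show "m \<in> V.span (\<Union>\<mu>\<in>dual sc H. weight_summand \<mu>)" by blast
qed

lemma O_direct_sum: "internal_direct_sum (dual sc H) weight_summand M"
  unfolding internal_direct_sum_iff
proof (intro conjI ballI)
  show "weight_summand \<mu> \<subseteq> M" for \<mu> by (rule weight_summand_subset)
  fix m assume m: "m \<in> M"
  then obtain c where c: "decomposes_as (dual sc H) weight_summand c m"
    using V.span_Union_decomposes[of "dual sc H" weight_summand m] weight_summand_subspace carrier_spanned by blast
  have "c' = c" if c': "decomposes_as (dual sc H) weight_summand c' m" for c'
  proof
    fix \<nu>
    \<comment> \<open>Subtracting two decompositions of \<open>m\<close> gives one of 0. A nonzero
      entry of it would be a sum of vectors of other weights, against independence.\<close>
    have "decomposes_as (dual sc H) weight_summand (\<lambda>\<mu>. c \<mu> + sm (- 1) (c' \<mu>)) (m + sm (- 1) m)"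
      by (intro V.decomposes_as_add V.decomposes_as_scale weight_summand_subspace c c')
    then have d: "decomposes_as (dual sc H) weight_summand (\<lambda>\<mu>. c \<mu> - c' \<mu>) 0"
      by simp
    let ?d = "\<lambda>\<mu>. c \<mu> - c' \<mu>" let ?F = "{\<mu>. ?d \<mu> \<noteq> 0}"
    show "c' \<nu> = c \<nu>"
    proof (rule ccontr)
      assume "c' \<nu> \<noteq> c \<nu>"
      then have \<nu>: "\<nu> \<in> ?F" by simp
      have F: "finite ?F" "?F \<subseteq> dual sc H" "\<And>\<mu>. \<mu> \<in> dual sc H \<Longrightarrow> ?d \<mu> \<in> weight_summand \<mu>"
        using d by (auto simp: decomposes_as_def)
      have "0 = ?d \<nu> + (\<Sum>\<mu>\<in>?F - {\<nu>}. ?d \<mu>)"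
        using sum.remove[OF F(1) \<nu>, of ?d] d by (simp add: decomposes_as_def)
      then have "?d \<nu> = (\<Sum>\<mu>\<in>?F - {\<nu>}. - ?d \<mu>)"
        by (simp only: sum_negf eq_neg_iff_add_eq_0)
      then have "?d \<nu> = 0"
      proof (rule hbar.weight_parts_independent[of "?F - {\<nu>}" \<nu>, rotated -1])
        show "?d \<nu> \<in> hbar.weight_part \<nu>" using F(2,3) \<nu> unfolding weight_summand_eq by blast
        show "- ?d \<mu> \<in> hbar.weight_part \<mu>" if "\<mu> \<in> ?F - {\<nu>}" for \<mu>
          using F(2,3) that V.subspace_neg[OF hbar.weight_part_subspace] unfolding weight_summand_eq by blast
      qed (use F(1,2) \<nu> in auto)
      with \<nu> show False by simp
    qed
  qed
  with c show "\<exists>!c. decomposes_as (dual sc H) weight_summand c m" by blast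
qed

interpretation decomposition: module_decomposition "takiff_scale sc" "takiff_bracket bracket" sm act M "dual sc H" weight_summand
  by unfold_locales
    (auto intro: weight_summand_subspace gen_weight_space_act[OF O_lie_module lie_alg] O_direct_sum)

lemma O_mu_gen_weight_space:
  assumes "\<mu> \<in> dual sc H"
  shows "category_O_mu sc bracket H P \<mu> sm act (weight_summand \<mu>)"
  unfolding category_O_mu_def category_O_def
proof (intro conjI)
  show "lie_module (takiff_scale sc) (takiff_bracket bracket) sm act (weight_summand \<mu>)"
    by (rule submodule[OF weight_summand_subspace weight_summand_subset gen_weight_space_act[OF O_lie_module lie_alg]])
  show "finitely_generated sm act (weight_summand \<mu>)"
    using O by (intro decomposition.finitely_generated_summand assms) (simp add: category_O_def)
  show "weight_summand \<mu> = V.span {m \<in> weight_summand \<mu>. \<exists>\<nu>\<in>dual sc H. \<forall>h\<in>H. act (h, 0) m = sm (\<nu> h) m}"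
    using O by (intro decomposition.spanned_by_eigenvectors_summand assms) (simp add: category_O_def)
  \<comment> \<open>Nilpotency is tested on single vectors, so it is unaffected when the carrier
    shrinks.\<close>
  show "weight_summand \<mu> = gen_weight_space H sm act (weight_summand \<mu>) \<mu>"
    by (auto simp: gen_weight_space_def)
qed (use O in \<open>auto simp: category_O_def intro: acts_locally_finitely_subset[OF _ weight_summand_subset]\<close>)

lemma O_finite_support: "finite {\<mu> \<in> dual sc H. weight_summand \<mu> \<noteq> {0}}"
  using O by (intro decomposition.finite_nonzero_summands) (simp add: category_O_def)

end

text \<open>As \<open>f\<close> intertwines the shifts, \<open>f m\<close> is a generalized
  eigenvector for \<open>\<mu> h\<close>; lying in \<open>B\<close>, it is also one for
  \<open>\<mu>' h\<close>. With \<open>h\<close> chosen where the functionals differ, its last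
  nonzero iterate would have two eigenvalues.\<close>

lemma hom_between_weights_zero:
  assumes "lie_algebra sc bracket" "module.subspace sc H"
    and "\<mu> \<in> dual sc H" "\<mu>' \<in> dual sc H" "\<mu> \<noteq> \<mu>'"
    and A: "category_O_mu sc bracket H P \<mu> sa actA A"
    and B: "category_O_mu sc bracket H P \<mu>' sb actB B"
    and f: "module_hom_on sa actA A sb actB B f" and m: "m \<in> A"
  shows "f m = 0"
proof (rule ccontr)
  assume "f m \<noteq> 0"
  interpret A: lie_module "takiff_scale sc" "takiff_bracket bracket" sa actA A
    using A by (simp add: category_O_mu_def category_O_def)
  interpret B: lie_module "takiff_scale sc" "takiff_bracket bracket" sb actB B
    using B by (simp add: category_O_mu_def category_O_def)
  interpret hbar: commuting_operators sc sb H B "\<lambda>h. actB (0, h)"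
    by (rule commuting_operators_takiff[OF B.lie_module_axioms assms(1,2)])
  obtain h where h: "h \<in> H" "\<mu> h \<noteq> \<mu>' h"
    using dual_neq_obtains[OF assms(3-5)] .
  let ?A = "\<lambda>v. actA (0, h) v - sa (\<mu> h) v"
  have opA: "operator_on sa A ?A" by (rule A.V.operator_on_shift[OF A.act_operator])
  have fm: "f v \<in> B" "f (actA x v) = actB x (f v)" "f (sa c v) = sb c (f v)" if "v \<in> A" for v x c
    using f that unfolding module_hom_on_def by blast+
  have f_add: "f (v + w) = f v + f w" if "v \<in> A" "w \<in> A" for v w
    using f that by (auto simp: module_hom_on_def)
  \<comment> \<open>Only additivity of \<open>f\<close> is at hand, so the difference is recovered
    from the sum of \<open>?A v\<close> and \<open>sa (\<mu> h) v\<close>.\<close>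
  have f_A: "f (?A v) = hbar.shift h (\<mu> h) (f v)" if "v \<in> A" for v
    using f_add[of "?A v" "sa (\<mu> h) v"] fm[OF that] that A.V.operator_on_closed[OF opA that]
      A.V.subspace_scale[OF A.carrier_subspace that]
    by (simp add: hbar.shift_def)
  have f_pow: "f ((?A ^^ n) m) = (hbar.shift h (\<mu> h) ^^ n) (f m)" for n
    by (induction n) (simp_all add: f_A A.V.operator_on_closed[OF A.V.operator_on_funpow[OF opA] m])
  obtain n where "(?A ^^ n) m = 0"
    using A m h(1) unfolding category_O_mu_def gen_weight_space_def by blast
  then have "(hbar.shift h (\<mu> h) ^^ n) (f m) = 0"
    using f_pow[of n] fm(3)[OF m, of 0] by simp
  then obtain k where k: "(hbar.shift h (\<mu> h) ^^ k) (f m) \<noteq> 0"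
      "hbar.shift h (\<mu> h) ((hbar.shift h (\<mu> h) ^^ k) (f m)) = 0"
    using funpow_kernel_nonzero \<open>f m \<noteq> 0\<close> by blast
  have in_B: "(hbar.shift h (\<mu> h) ^^ k) (f m) \<in> B"
    using B.V.operator_on_closed[OF hbar.shift_pow_operator[OF h(1)] fm(1)[OF m]] .
  then obtain l where "(hbar.shift h (\<mu>' h) ^^ l) ((hbar.shift h (\<mu> h) ^^ k) (f m)) = 0"
    using B h(1) unfolding category_O_mu_def gen_weight_space_def hbar.shift_def[abs_def] by blast
  then have "\<mu> h = \<mu>' h"
    using hbar.eigenvalue_unique[OF h(1) in_B _ k(1)] k(2) by (simp add: hbar.shift_def)
  with h(2) show False by simp
qed

theorem corollary3p8:
  fixes sc :: "complex \<Rightarrow> 'g::ab_group_add \<Rightarrow> 'g"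
    and bracket :: "'g \<Rightarrow> 'g \<Rightarrow> 'g"
    and G :: "(complex^'n^'n) set"
    and \<phi> :: "'g \<Rightarrow> complex^'n^'n"
    and H :: "'g set"
    and P :: "('g \<Rightarrow> complex) set"
  assumes "connected_reductive_group G"
    and "lie_algebra_of_group sc bracket G \<phi>"
    and "maximal_toral_subalgebra sc bracket \<phi> H"
    and "positive_system sc bracket H P"
  shows "(\<forall>(sm :: complex \<Rightarrow> 'm::ab_group_add \<Rightarrow> 'm) act M.
            category_O sc bracket H P sm act M \<longrightarrow>
            (\<exists>D. (\<forall>\<mu>\<in>dual sc H. category_O_mu sc bracket H P \<mu> sm act (D \<mu>)) \<and>
                 internal_direct_sum (dual sc H) D M \<and>
                 finite {\<mu> \<in> dual sc H. D \<mu> \<noteq> {0}}))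
       \<and> (\<forall>(sa :: complex \<Rightarrow> 'a::ab_group_add \<Rightarrow> 'a) actA A
            (sb :: complex \<Rightarrow> 'b::ab_group_add \<Rightarrow> 'b) actB B f.
            \<forall>\<mu>\<in>dual sc H. \<forall>\<mu>'\<in>dual sc H. \<mu> \<noteq> \<mu>' \<longrightarrow>
              category_O_mu sc bracket H P \<mu> sa actA A \<longrightarrow>
              category_O_mu sc bracket H P \<mu>' sb actB B \<longrightarrow>
              module_hom_on sa actA A sb actB B f \<longrightarrow>
              (\<forall>m\<in>A. f m = 0))"
proof -
  have g: "lie_algebra sc bracket" using assms(2) by (simp add: lie_algebra_of_group_def)
  have H: "module.subspace sc H"
    using assms(3) by (simp add: maximal_toral_subalgebra_def toral_subalgebra_def)
  show ?thesis
  proof (rule conjI)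
    show "\<forall>(sm :: complex \<Rightarrow> 'm \<Rightarrow> 'm) act M. category_O sc bracket H P sm act M \<longrightarrow>
            (\<exists>D. (\<forall>\<mu>\<in>dual sc H. category_O_mu sc bracket H P \<mu> sm act (D \<mu>)) \<and>
                 internal_direct_sum (dual sc H) D M \<and>
                 finite {\<mu> \<in> dual sc H. D \<mu> \<noteq> {0}})"
      \<comment> \<open>The witness for \<open>D\<close> is
        \<open>gen_weight_space H sm act M\<close>.\<close>
      using O_mu_gen_weight_space[OF g H] O_direct_sum[OF g H] O_finite_support[OF g H] by blast
  qed (use hom_between_weights_zero[OF g H] in blast)
qed

end
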